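(* Let $\mathscr{M}=(X,\mathcal I)$ and $\mathscr{N}=(Y,\mathcal J)$ be matroids, and let $\Phi:\mathscr M\to\mathscr N$ be a morphism of matroids. Let $\omega:X\to\mathbb R_{>0}$ be a positive weight function and let $1\le k<\mathrm{rk}(\mathscr M)$. Then $$\mathrm B_\omega(k)^2\ \ge\ \Bigl(1+\frac1k\Bigr)\Bigl(1+\frac{1}{p(k-1)-1}\Bigr)\,\mathrm B_\omega(k-1)\,\mathrm B_\omega(k+1).$$
   Context: Matroids are finite, given by ground set and independent sets. The rank functions of $\mathscr M$ and $\mathscr N$ are $f(S)=\max\{|A|:A\subseteq S, A\in\mathcal I\}$ for $S\subseteq X$, and $g$ defined likewise on subsets of $Y$; $\mathrm{rk}(\mathscr M)=f(X)$, $\mathrm{rk}(\mathscr N)=g(Y)$. A morphism $\Phi:\mathscr M\to\mathscr N$ is a function $\Phi:X\to Y$ with $g(\Phi(T))-g(\Phi(S))\le f(T)-f(S)$ for all $S\subseteq T\subseteq X$. A set $S\in\mathcal I$ is a basis of $\Phi$ if $g(\Phi(S))=\mathrm{rk}(\mathscr N)$. Let $\mathcal B$ be the set of bases of $\Phi$ and $\mathcal B_j=\{S\in\mathcal B:|S|=j\}$. Put $\omega(S)=\prod_{x\in S}\omega(x)$ and $\mathrm B_\omega(j)=\sum_{S\in\mathcal B_j}\omega(S)$. For $S\in\mathcal I$, let $\mathrm{Cont}(S)=\{x\in X\setminus S: S\cup\{x\}\in\mathcal I\}$. For $x,y\in\mathrm{Cont}(S)$ write $x\sim_S y$ if $x=y$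 or $S\cup\{x,y\}\notin\mathcal I$; this is an equivalence relation, and $\mathrm{Par}(S)$ denotes its set of equivalence classes (parallel classes). Let $p(j)=\max\{|\mathrm{Par}(S)|:S\in\mathcal B_j\}$, with $p(j)=0$ if $\mathcal B_j=\varnothing$. *)

theory Defs
  imports Complex_Main "HOL-Library.FuncSet"
begin

locale matroid =
  fixes X :: "'a set" and \<I> :: "'a set set"
  assumes finite_ground: "finite X"
    and indep_subset_ground: "\<And>A. A \<in> \<I> \<Longrightarrow> A \<subseteq> X"
    and empty_indep: "{} \<in> \<I>"
    and indep_subset: "\<And>A B. A \<in> \<I> \<Longrightarrow> B \<subseteq> A \<Longrightarrow> B \<in> \<I>"
    and augment: "\<And>A B. A \<in> \<I> \<Longrightarrow> B \<in> \<I> \<Longrightarrow> card A < card B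
                  \<Longrightarrow> \<exists>x \<in> B - A. insert x A \<in> \<I>"

definition rank_of :: "'a set set \<Rightarrow> 'a set \<Rightarrow> nat" where
  "rank_of \<I> S = Max (card ` {A \<in> \<I>. A \<subseteq> S})"

(* The differences of ranks are taken in the integers, since subtraction on nat truncates. *)
definition matroid_morphism ::
  "'a set \<Rightarrow> 'a set set \<Rightarrow> 'b set \<Rightarrow> 'b set set \<Rightarrow> ('a \<Rightarrow> 'b) \<Rightarrow> bool" where
  "matroid_morphism X \<I> Y \<J> \<Phi> \<longleftrightarrow>
     matroid X \<I> \<and> matroid Y \<J> \<and> \<Phi> \<in> X \<rightarrow> Y \<and>
     (\<forall>S T. S \<subseteq> T \<and> T \<subseteq> X \<longrightarrow>
        int (rank_of \<J> (\<Phi> ` T)) - int (rank_of \<J> (\<Phi> ` S))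
          \<le> int (rank_of \<I> T) - int (rank_of \<I> S))"

definition morphism_bases ::
  "'a set set \<Rightarrow> 'b set \<Rightarrow> 'b set set \<Rightarrow> ('a \<Rightarrow> 'b) \<Rightarrow> 'a set set" where
  "morphism_bases \<I> Y \<J> \<Phi> = {S \<in> \<I>. rank_of \<J> (\<Phi> ` S) = rank_of \<J> Y}"

definition morphism_bases_of_card ::
  "'a set set \<Rightarrow> 'b set \<Rightarrow> 'b set set \<Rightarrow> ('a \<Rightarrow> 'b) \<Rightarrow> nat \<Rightarrow> 'a set set" where
  "morphism_bases_of_card \<I> Y \<J> \<Phi> j = {S \<in> morphism_bases \<I> Y \<J> \<Phi>. card S = j}"

definition weighted_bases ::
  "'a set set \<Rightarrow> 'b set \<Rightarrow> 'b set set \<Rightarrow> ('a \<Rightarrow> 'b) \<Rightarrow> ('a \<Rightarrow> real) \<Rightarrow> nat \<Rightarrow> real" where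
  "weighted_bases \<I> Y \<J> \<Phi> \<omega> j =
     (\<Sum>S \<in> morphism_bases_of_card \<I> Y \<J> \<Phi> j. \<Prod>x\<in>S. \<omega> x)"

definition continuations :: "'a set \<Rightarrow> 'a set set \<Rightarrow> 'a set \<Rightarrow> 'a set" where
  "continuations X \<I> S = {x \<in> X - S. S \<union> {x} \<in> \<I>}"

definition parallel_rel :: "'a set \<Rightarrow> 'a set set \<Rightarrow> 'a set \<Rightarrow> ('a \<times> 'a) set" where
  "parallel_rel X \<I> S =
     {(x, y). x \<in> continuations X \<I> S \<and> y \<in> continuations X \<I> S \<and>
              (x = y \<or> S \<union> {x, y} \<notin> \<I>)}"

definition parallel_classes :: "'a set \<Rightarrow> 'a set set \<Rightarrow> 'a set \<Rightarrow> 'a set set" where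
  "parallel_classes X \<I> S = continuations X \<I> S // parallel_rel X \<I> S"

definition max_parallel_classes ::
  "'a set \<Rightarrow> 'a set set \<Rightarrow> 'b set \<Rightarrow> 'b set set \<Rightarrow> ('a \<Rightarrow> 'b) \<Rightarrow> nat \<Rightarrow> nat" where
  "max_parallel_classes X \<I> Y \<J> \<Phi> j =
     (if morphism_bases_of_card \<I> Y \<J> \<Phi> j = {} then 0
      else Max ((\<lambda>S. card (parallel_classes X \<I> S)) ` morphism_bases_of_card \<I> Y \<J> \<Phi> j))"

lemma (in matroid) equiv_parallel_rel:
  assumes "S \<in> \<I>"
  shows "equiv (continuations X \<I> S) (parallel_rel X \<I> S)"
proof (rule equivI)
  show "parallel_rel X \<I> S \<subseteq> continuations X \<I> S \<times> continuations X \<I> S"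
    by (auto simp: parallel_rel_def)
  show "refl_on (continuations X \<I> S) (parallel_rel X \<I> S)"
    by (auto simp: refl_on_def parallel_rel_def)
  show "sym (parallel_rel X \<I> S)"
    by (auto simp: sym_def parallel_rel_def insert_commute)
  show "trans (parallel_rel X \<I> S)"
  proof (rule transI)
    fix x y z
    assume xy: "(x, y) \<in> parallel_rel X \<I> S" and yz: "(y, z) \<in> parallel_rel X \<I> S"
    have cont: "x \<in> continuations X \<I> S" "y \<in> continuations X \<I> S" "z \<in> continuations X \<I> S"
      using xy yz by (auto simp: parallel_rel_def)
    have "S \<union> {x, z} \<notin> \<I>" if ne: "x \<noteq> y" "y \<noteq> z" "x \<noteq> z"
    proof
      assume xz: "S \<union> {x, z} \<in> \<I>"
      have fin: "finite S"
        using assms indep_subset_ground finite_ground finite_subset by blast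
      have nin: "x \<notin> S" "y \<notin> S" "z \<notin> S" and y: "S \<union> {y} \<in> \<I>"
        using cont by (auto simp: continuations_def)
      have "card (S \<union> {y}) < card (S \<union> {x, z})"
        using fin nin ne by simp
      then obtain e where "e \<in> (S \<union> {x, z}) - (S \<union> {y})" "insert e (S \<union> {y}) \<in> \<I>"
        using augment[OF y xz] by blast
      then have "S \<union> {x, y} \<in> \<I> \<or> S \<union> {y, z} \<in> \<I>"
        by (auto simp: insert_commute)
      then show False
        using xy yz ne by (auto simp: parallel_rel_def)
    qed
    then show "(x, z) \<in> parallel_rel X \<I> S"
      using xy yz cont by (auto simp: parallel_rel_def)
  qed
qed

end

theory Submission
  imports Defs "HOL-Analysis.Analysis"
begin

text \<open>
  Let r be the rank of the target and e(n) the weighted generating polynomial of the bases of the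
  morphism with n elements. The polynomial
  e(k+1) + z e(k) + (c/2) z^2 e(k-1) with c = 1 + 1/(p(k-1) - 1) is Lorentzian, and the claim
  is its log-concavity in the direction of the extra variable z as z tends to 0.
  The Lorentzian property is proved by passing from quadratic derivatives to derivatives of higher
  degree: the Hessian H of a polynomial of degree at least 3 is a positive combination of the Hessians
  of its partial derivatives. If these have at most one positive eigenvalue, then the eigenvalues
  of the normalised H satisfy q <= q^2, so none lies strictly between 0 and 1, and
  by Perron-Frobenius the eigenvalue 1 is simple and maximal when the support of H is connected.
  The quadratic derivatives are complete multipartite forms on parallel classes, bordered by the
  variable z, and the constant c is exactly what the number of parallel classes allows.
\<close>

section \<open>Quadratic forms with one positive direction\<close>

text \<open>The numbers e(k+1), e(k), e(k-1) belong to three different matroids, the sets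
  \<open>lift n\<close> for n = k+1, k, k-1. The variable z links them: each derivative in z lowers
  n by one. Hence a quadratic derivative left after fixing a set S of elements has its inner block
  from \<open>lift n\<close>, its border from \<open>lift (n - 1)\<close> and its corner from
  \<open>lift (n - 2)\<close>, and these lifts have to be compared above S.

  The corner survives only if no derivative in z was taken and S is a basis of the morphism with k-1
  elements. Let t be the sum of the weighted variables and P the sum of the squared sums over
  parallel classes. Up to a positive factor the form is then t^2 - P + 2 t z + c z^2, and on c z =
  -t it equals (1 - 1/c) t^2 - P. By Cauchy-Schwarz P is at least t^2 / p if there are at most p
  classes, so (1 - 1/c) p \<le> 1 suffices; for p > 1 the largest such c is 1 + 1/(p-1). The factor
  1 + 1/k is (k+1)! (k-1)! / (k!)^2 and comes from Euler's identity.\<close>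

definition quad_form :: "'v set \<Rightarrow> ('v \<Rightarrow> 'v \<Rightarrow> real) \<Rightarrow> ('v \<Rightarrow> real) \<Rightarrow> real" where
  "quad_form V H v = (\<Sum>i\<in>V. \<Sum>j\<in>V. H i j * v i * v j)"

text \<open>
  The reverse Cauchy-Schwarz inequality only against the all-ones vector. This suffices for the
  induction below, since weights are absorbed into the coefficients and the evaluation point becomes 1.
\<close>
definition hyperbolic_at_one :: "'v set \<Rightarrow> ('v \<Rightarrow> 'v \<Rightarrow> real) \<Rightarrow> bool" where
  "hyperbolic_at_one V H \<longleftrightarrow>
     (\<forall>v. quad_form V H v * (\<Sum>i\<in>V. \<Sum>j\<in>V. H i j) \<le> (\<Sum>i\<in>V. (\<Sum>j\<in>V. H i j) * v i)\<^sup>2)"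

lemma quad_form_add_scale:
  assumes "\<And>i j. i \<in> V \<Longrightarrow> j \<in> V \<Longrightarrow> H i j = H j i"
  shows "quad_form V H (\<lambda>i. v i + t * u i) =
    quad_form V H v + 2 * t * (\<Sum>i\<in>V. (\<Sum>j\<in>V. H i j * v j) * u i) + t\<^sup>2 * quad_form V H u"
proof -
  have swap: "(\<Sum>i\<in>V. \<Sum>j\<in>V. H i j * v i * u j) = (\<Sum>i\<in>V. \<Sum>j\<in>V. H i j * v j * u i)"
    by (subst sum.swap) (intro sum.cong refl, auto simp: assms)
  have "quad_form V H (\<lambda>i. v i + t * u i) =
    quad_form V H v + t * (\<Sum>i\<in>V. \<Sum>j\<in>V. H i j * v i * u j)
      + t * (\<Sum>i\<in>V. \<Sum>j\<in>V. H i j * v j * u i) + t\<^sup>2 * quad_form V H u"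
    by (simp add: quad_form_def sum_distrib_left sum.distrib[symmetric] algebra_simps power2_eq_square)
  then show ?thesis
    by (simp add: swap sum_distrib_right)
qed

text \<open>Shifting \<open>v\<close> by a multiple of the all-ones vector moves it into the
  hyperplane; completing the square in the shift yields the inequality. The functional
  \<open>l\<close> is arbitrary, so each application picks the hyperplane on which its form is
  easiest to bound.\<close>

lemma hyperbolic_at_oneI:
  assumes sym: "\<And>i j. i \<in> V \<Longrightarrow> j \<in> V \<Longrightarrow> H i j = H j i"
    and nonneg: "\<And>i j. i \<in> V \<Longrightarrow> j \<in> V \<Longrightarrow> H i j \<ge> 0"
    and neg: "\<And>v. (\<Sum>i\<in>V. l i * v i) = 0 \<Longrightarrow> quad_form V H v \<le> 0"
  shows "hyperbolic_at_one V H"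
  unfolding hyperbolic_at_one_def
proof
  fix v :: "'a \<Rightarrow> real"
  define M where "M = (\<Sum>i\<in>V. \<Sum>j\<in>V. H i j)"
  define B where "B = (\<Sum>i\<in>V. (\<Sum>j\<in>V. H i j) * v i)"
  have M0: "M \<ge> 0"
    unfolding M_def using nonneg by (intro sum_nonneg)
  have one: "quad_form V H (\<lambda>_. 1) = M"
    by (simp add: quad_form_def M_def)
  have "quad_form V H v * M \<le> B\<^sup>2"
  proof (cases "sum l V = 0")
    case True
    \<comment> \<open>Here the all-ones vector lies in the hyperplane itself, which forces the total
      \<open>M\<close> to vanish.\<close>
    then have "M \<le> 0"
      using neg[of "\<lambda>_. 1"] one by simp
    with M0 show ?thesis by simp
  next
    case False
    define s where "s = (\<Sum>i\<in>V. l i * v i) / sum l V"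
    have "(\<Sum>i\<in>V. l i * (v i + (-s) * 1)) = (\<Sum>i\<in>V. l i * v i) - s * sum l V"
      by (simp add: algebra_simps sum.distrib sum_subtractf sum_distrib_left)
    also have "\<dots> = 0"
      using False by (simp add: s_def)
    finally have "quad_form V H (\<lambda>i. v i + (-s) * 1) \<le> 0"
      by (rule neg)
    moreover have "(\<Sum>i\<in>V. (\<Sum>j\<in>V. H i j * v j)) = B"
      unfolding B_def sum_distrib_right
      by (subst sum.swap) (intro sum.cong refl, auto simp: sym)
    ultimately have "quad_form V H v - 2 * s * B + s\<^sup>2 * M \<le> 0"
      using quad_form_add_scale[where V=V and H=H and v=v and t="-s" and u="\<lambda>_. 1"] sym one by simp
    then have "(quad_form V H v - 2 * s * B + s\<^sup>2 * M) * M \<le> 0"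
      using M0 by (simp add: mult_nonpos_nonneg)
    moreover have "B\<^sup>2 - quad_form V H v * M
      = (B - s * M)\<^sup>2 - (quad_form V H v - 2 * s * B + s\<^sup>2 * M) * M"
      by (simp add: power2_eq_square algebra_simps)
    ultimately show ?thesis
      using zero_le_power2[of "B - s * M"] by linarith
  qed
  then show "quad_form V H v * (\<Sum>i\<in>V. \<Sum>j\<in>V. H i j) \<le> (\<Sum>i\<in>V. (\<Sum>j\<in>V. H i j) * v i)\<^sup>2"
    by (simp add: M_def B_def)
qed

text \<open>The \<open>m\<close>-unit sphere in the hyperplane orthogonal to 1 is compact, so the
  form has a maximiser on it; homogeneity spreads the bound to all \<open>u\<close>. The vector
  \<open>w\<close> certifies that the sphere is nonempty.\<close>

lemma quad_form_attains_max:
  fixes m :: "'v \<Rightarrow> real"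
  assumes fin: "finite V" and pos: "\<And>i. i \<in> V \<Longrightarrow> m i > 0"
    and w: "(\<Sum>i\<in>V. m i * w i) = 0" "w k \<noteq> 0" "k \<in> V"
  obtains v where "(\<Sum>i\<in>V. m i * v i) = 0" "(\<Sum>i\<in>V. m i * (v i)\<^sup>2) = 1"
    "\<And>u. (\<Sum>i\<in>V. m i * u i) = 0 \<Longrightarrow>
       quad_form V H u \<le> quad_form V H v * (\<Sum>i\<in>V. m i * (u i)\<^sup>2)"
proof -
  define N where "N u = (\<Sum>i\<in>V. m i * (u i)\<^sup>2)" for u :: "'v \<Rightarrow> real"
  \<comment> \<open>Vectors are functions on the whole type, so the coordinates outside
    \<open>V\<close> are pinned to 0 for compactness. Inside \<open>V\<close> the bounds follow from
    \<open>N v = 1\<close>.\<close>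
  define box where "box = Pi\<^sub>E UNIV (\<lambda>i. if i \<in> V then {- sqrt (1 / m i)..sqrt (1 / m i)} else {0})"
  define S where "S = box \<inter> {v. (\<Sum>i\<in>V. m i * v i) = 0} \<inter> {v. N v = 1}"
  have N0: "N u \<ge> 0" for u
    unfolding N_def using pos by (intro sum_nonneg) (auto intro!: mult_nonneg_nonneg simp: less_imp_le)
  have Npos: "N u > 0" if "i \<in> V" "u i \<noteq> 0" for u i
    unfolding N_def using that fin pos
    by (intro sum_pos2[of _ i]) (auto intro!: mult_nonneg_nonneg simp: less_imp_le)
  have cont: "continuous_on UNIV (\<lambda>v::'v \<Rightarrow> real. v i)" for i
    by (rule continuous_on_product_coordinates)
  have "compact box"
  proof -
    have "compactin (product_topology (\<lambda>i. euclidean) UNIV) box"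
      unfolding box_def compactin_PiE by auto
    then show ?thesis
      by (simp add: euclidean_product_topology)
  qed
  moreover have "closed {v. (\<Sum>i\<in>V. m i * v i) = 0}"
    by (intro closed_Collect_eq continuous_intros cont)
  moreover have "closed {v. N v = 1}"
    unfolding N_def by (intro closed_Collect_eq continuous_intros cont)
  ultimately have compS: "compact S"
    unfolding S_def by (intro compact_Int_closed)
  define nrm where "nrm u i = (if i \<in> V then u i / sqrt (N u) else 0)" for u i
  have nrm: "nrm u \<in> S" if "(\<Sum>i\<in>V. m i * u i) = 0" "N u > 0" for u
  proof -
    have "(\<Sum>i\<in>V. m i * nrm u i) = (\<Sum>i\<in>V. m i * u i) / sqrt (N u)"
      by (simp add: nrm_def sum_divide_distrib)
    moreover have "N (nrm u) = N u / N u"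
      using that by (simp add: N_def[of "nrm u"] nrm_def power_divide sum_divide_distrib[symmetric])
        (simp add: N_def)
    moreover have "nrm u i \<in> {- sqrt (1 / m i)..sqrt (1 / m i)}" if i: "i \<in> V" for i
    proof -
      have "m i * (u i)\<^sup>2 \<le> N u"
        unfolding N_def using i fin pos
        by (intro member_le_sum) (auto intro!: mult_nonneg_nonneg simp: less_imp_le)
      then have "(nrm u i)\<^sup>2 \<le> 1 / m i"
        using i pos[OF i] \<open>N u > 0\<close> by (simp add: nrm_def power_divide field_simps)
      then have "\<bar>nrm u i\<bar> \<le> sqrt (1 / m i)"
        by (metis real_sqrt_abs real_sqrt_le_mono)
      then show ?thesis by auto
    qed
    ultimately show ?thesis
      using that by (auto simp: S_def box_def nrm_def PiE_iff)
  qed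
  have "S \<noteq> {}"
    using nrm[OF w(1)] Npos[of k w] w by auto
  moreover have "continuous_on S (quad_form V H)"
    unfolding quad_form_def
    by (intro continuous_intros continuous_on_subset[OF cont subset_UNIV])
  ultimately obtain v where v: "v \<in> S" "\<And>u. u \<in> S \<Longrightarrow> quad_form V H u \<le> quad_form V H v"
    using continuous_attains_sup[OF compS] by blast
  show thesis
  proof
    show "(\<Sum>i\<in>V. m i * v i) = 0" "(\<Sum>i\<in>V. m i * (v i)\<^sup>2) = 1"
      using v(1) by (auto simp: S_def N_def)
    fix u assume u: "(\<Sum>i\<in>V. m i * u i) = 0"
    show "quad_form V H u \<le> quad_form V H v * (\<Sum>i\<in>V. m i * (u i)\<^sup>2)"
    proof (cases "N u > 0")
      case True
      then have "quad_form V H (nrm u) = quad_form V H u / N u"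
        by (simp add: quad_form_def nrm_def sum_divide_distrib cong: sum.cong)
      moreover have "quad_form V H (nrm u) \<le> quad_form V H v"
        using nrm[OF u True] v by blast
      ultimately show ?thesis
        using True by (simp add: N_def[symmetric] pos_divide_le_eq)
    next
      case False
      then have "N u = 0" "\<forall>i\<in>V. u i = 0"
        using N0[of u] Npos by (auto simp: less_le)
      then show ?thesis
        by (simp add: N_def[symmetric] quad_form_def)
    qed
  qed
qed

text \<open>First-order condition at a maximum: for small positive \<open>t\<close> the linear term
  would dominate. In its use \<open>a\<close> is twice a weighted squared norm, whence the sign
  condition.\<close>

lemma nonpos_linear_coefficient:
  fixes a b :: real
  assumes "\<And>t. t * a + t\<^sup>2 * b \<le> 0" and "a \<ge> 0"
  shows "a = 0"
proof (rule ccontr)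
  assume "a \<noteq> 0"
  then have a: "a > 0" using assms by simp
  define B where "B = \<bar>b\<bar> + 1"
  define t where "t = a / B / 2"
  have B: "B > 0" by (simp add: B_def add_nonneg_pos)
  then have t: "t > 0" using a by (simp add: t_def)
  have "t * \<bar>b\<bar> < a"
  proof -
    have "t * \<bar>b\<bar> \<le> t * B" using t by (simp add: B_def)
    also have "\<dots> = a / 2" using B by (simp add: t_def)
    finally show ?thesis using a by simp
  qed
  then have "0 < a + t * b"
    using t by (smt (verit) abs_ge_minus_self mult_left_mono mult_minus_right)
  then have "0 < t * (a + t * b)" using t by simp
  then show False using assms(1)[of t] by (simp add: power2_eq_square algebra_simps)
qed


text \<open>The Dirichlet form of the graph with edge weights \<open>H\<close>: the row sums are the
  degrees, and their diagonal matrix minus \<open>H\<close> is the Laplacian.\<close>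

lemma weighted_squares_minus_quad_form:
  assumes sym: "\<And>i j. i \<in> V \<Longrightarrow> j \<in> V \<Longrightarrow> H i j = H j i"
  shows "2 * ((\<Sum>i\<in>V. (\<Sum>j\<in>V. H i j) * (v i)\<^sup>2) - quad_form V H v)
    = (\<Sum>i\<in>V. \<Sum>j\<in>V. H i j * (v i - v j)\<^sup>2)"
proof -
  have "(\<Sum>i\<in>V. \<Sum>j\<in>V. H i j * (v j)\<^sup>2) = (\<Sum>i\<in>V. \<Sum>j\<in>V. H i j * (v i)\<^sup>2)"
    by (subst sum.swap) (intro sum.cong refl, auto simp: sym)
  moreover have "(\<Sum>i\<in>V. \<Sum>j\<in>V. H i j * (v i - v j)\<^sup>2)
    = (\<Sum>i\<in>V. \<Sum>j\<in>V. H i j * (v i)\<^sup>2) + (\<Sum>i\<in>V. \<Sum>j\<in>V. H i j * (v j)\<^sup>2)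
      - 2 * quad_form V H v"
    by (simp add: quad_form_def sum_distrib_left sum.distrib[symmetric] sum_subtractf[symmetric]
        algebra_simps power2_eq_square)
  ultimately show ?thesis
    by (simp add: sum_distrib_right)
qed

text \<open>
  Let m be the vector of row sums of H. The assumptions give v H v \<le> sum ((H v) i)^2 / m i, so a
  maximiser v of the form on the m-unit sphere orthogonal to 1 is an eigenvector whose eigenvalue q,
  if positive, satisfies q \<le> q^2. On the other hand v H v \<le> sum (m i * (v i)^2), with equality only
  if v is constant along edges.
\<close>
lemma hyperbolic_at_one_sum:
  fixes H :: "'v \<Rightarrow> 'v \<Rightarrow> real"
  assumes fin: "finite V"
    and sym: "\<And>i j. i \<in> V \<Longrightarrow> j \<in> V \<Longrightarrow> H i j = H j i"
    and nonneg: "\<And>l i j. l \<in> V \<Longrightarrow> i \<in> V \<Longrightarrow> j \<in> V \<Longrightarrow> K l i j \<ge> 0"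
    and decomp: "\<And>i j. i \<in> V \<Longrightarrow> j \<in> V \<Longrightarrow> H i j = (\<Sum>l\<in>V. K l i j)"
    and rows: "\<And>l i. l \<in> V \<Longrightarrow> i \<in> V \<Longrightarrow> (\<Sum>j\<in>V. K l i j) = H l i"
    and hyp: "\<And>l. l \<in> V \<Longrightarrow> hyperbolic_at_one V (K l)"
    and conn: "\<And>i j. i \<in> V \<Longrightarrow> j \<in> V \<Longrightarrow> (\<Sum>l\<in>V. H i l) > 0 \<Longrightarrow> (\<Sum>l\<in>V. H j l) > 0 \<Longrightarrow>
       (\<lambda>x y. x \<in> V \<and> y \<in> V \<and> H x y > 0)\<^sup>*\<^sup>* i j"
  shows "hyperbolic_at_one V H"
proof (rule hyperbolic_at_oneI[where l = "\<lambda>i. \<Sum>j\<in>V. H i j"])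
  show H0: "H i j \<ge> 0" if "i \<in> V" "j \<in> V" for i j
    using that by (simp add: decomp nonneg sum_nonneg)
  define m where "m i = (\<Sum>j\<in>V. H i j)" for i
  have m0: "m i \<ge> 0" if "i \<in> V" for i
    unfolding m_def using that by (intro sum_nonneg H0)
  \<comment> \<open>Dropping the zero rows makes \<open>m\<close> a genuine inner product on
    \<open>W\<close>; since \<open>H\<close> is symmetric and nonnegative, the form loses
    nothing.\<close>
  define W where "W = {i \<in> V. m i > 0}"
  have W: "finite W" "W \<subseteq> V" "\<And>i. i \<in> W \<Longrightarrow> m i > 0"
    using fin by (auto simp: W_def)
  have off: "m i = 0" if "i \<in> V - W" for i
    using that m0[of i] by (auto simp: W_def)
  have offH: "H i j = 0" if "i \<in> V" "j \<in> V" "i \<notin> W \<or> j \<notin> W" for i j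
  proof -
    have z: "H i j = 0" if "i \<in> V" "j \<in> V" "m i = 0" for i j
      using that sum_nonneg_eq_0_iff[OF fin, of "H i"] H0 by (auto simp: m_def)
    show ?thesis
      using that z[of i j] z[of j i] off sym by (metis DiffI)
  qed
  have sumW: "(\<Sum>i\<in>V. f i) = (\<Sum>i\<in>W. f i)" if "\<And>i. i \<in> V - W \<Longrightarrow> f i = 0" for f :: "'v \<Rightarrow> real"
    using that by (intro sum.mono_neutral_right fin W) auto
  have qW: "quad_form V H v = quad_form W H v" for v
    unfolding quad_form_def using W(2) offH
    by (intro sum.mono_neutral_cong_right fin) (auto intro!: sum.neutral sum.mono_neutral_cong_right fin)
  have mW: "m i = (\<Sum>j\<in>W. H i j)" if "i \<in> W" for i
    unfolding m_def using W(2) that offH by (intro sumW) auto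
  have symW: "H i j = H j i" if "i \<in> W" "j \<in> W" for i j
    using that W(2) sym by blast
  \<comment> \<open>Hyperbolicity bounds the form of \<open>K l\<close> by the square of its row-sum
    functional, which is row \<open>l\<close> of \<open>H\<close>, divided by its total
    \<open>m l\<close>. Summation over \<open>l\<close> gives the claim.\<close>
  have key: "quad_form W H v \<le> (\<Sum>i\<in>W. (\<Sum>j\<in>W. H i j * v j)\<^sup>2 / m i)" for v
  proof -
    have "quad_form (V) (K l) v \<le> (if l \<in> W then (\<Sum>j\<in>W. H l j * v j)\<^sup>2 / m l else 0)" if l: "l \<in> V" for l
    proof (cases "l \<in> W")
      case True
      have "quad_form V (K l) v * m l \<le> (\<Sum>i\<in>V. H l i * v i)\<^sup>2"
        using hyp[OF l] l by (simp add: hyperbolic_at_one_def rows m_def cong: sum.cong)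
      also have "(\<Sum>i\<in>V. H l i * v i) = (\<Sum>i\<in>W. H l i * v i)"
        using l offH by (intro sumW) auto
      finally show ?thesis
        using True W(3) by (simp add: pos_le_divide_eq)
    next
      case False
      have "K l i j = 0" if "i \<in> V" "j \<in> V" for i j
      proof -
        have "(\<Sum>j\<in>V. K l i j) = 0"
          using rows[of l i] l that False offH by simp
        then show ?thesis
          using sum_nonneg_eq_0_iff[OF fin, of "K l i"] nonneg l that by auto
      qed
      then show ?thesis
        using False by (simp add: quad_form_def)
    qed
    then have "(\<Sum>l\<in>V. quad_form V (K l) v)
        \<le> (\<Sum>l\<in>V. if l \<in> W then (\<Sum>j\<in>W. H l j * v j)\<^sup>2 / m l else 0)"
      by (rule sum_mono)
    also have "\<dots> = (\<Sum>i\<in>W. (\<Sum>j\<in>W. H i j * v j)\<^sup>2 / m i)"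
      by (subst sumW) auto
    also have "(\<Sum>l\<in>V. quad_form V (K l) v) = quad_form V H v"
    proof -
      have "(\<Sum>l\<in>V. quad_form V (K l) v) = (\<Sum>i\<in>V. \<Sum>l\<in>V. \<Sum>j\<in>V. K l i j * v i * v j)"
        unfolding quad_form_def by (rule sum.swap)
      also have "\<dots> = (\<Sum>i\<in>V. \<Sum>j\<in>V. \<Sum>l\<in>V. K l i j * v i * v j)"
        by (intro sum.cong refl sum.swap)
      also have "\<dots> = quad_form V H v"
        by (simp add: quad_form_def decomp sum_distrib_right cong: sum.cong)
      finally show ?thesis .
    qed
    finally show ?thesis by (simp add: qW)
  qed
  fix u assume u: "(\<Sum>i\<in>V. (\<Sum>j\<in>V. H i j) * u i) = 0"
  show "quad_form V H u \<le> 0"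
  proof (rule ccontr)
    assume neg: "\<not> quad_form V H u \<le> 0"
    have u0: "(\<Sum>i\<in>W. m i * u i) = 0"
      using u sumW[of "\<lambda>i. m i * u i"] off by (simp add: m_def)
    have "\<exists>k\<in>W. u k \<noteq> 0"
    proof (rule ccontr)
      assume "\<not> ?thesis"
      then have "quad_form W H u = 0" by (simp add: quad_form_def)
      with neg qW show False by simp
    qed
    then obtain k where k: "u k \<noteq> 0" "k \<in> W" by blast
    obtain v where v: "(\<Sum>i\<in>W. m i * v i) = 0" "(\<Sum>i\<in>W. m i * (v i)\<^sup>2) = 1"
      and max: "\<And>u. (\<Sum>i\<in>W. m i * u i) = 0 \<Longrightarrow>
         quad_form W H u \<le> quad_form W H v * (\<Sum>i\<in>W. m i * (u i)\<^sup>2)"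
      using quad_form_attains_max[where H = H, OF W(1,3) u0 k] by blast
    define q where "q = quad_form W H v"
    have "q > 0"
    proof (rule ccontr)
      assume "\<not> q > 0"
      then have "q * (\<Sum>i\<in>W. m i * (u i)\<^sup>2) \<le> 0"
        using W(3) by (intro mult_nonpos_nonneg sum_nonneg) (auto intro!: mult_nonneg_nonneg simp: less_imp_le)
      then show False using max[OF u0] neg by (simp add: qW q_def)
    qed
    define Hv where "Hv i = (\<Sum>j\<in>W. H i j * v j)" for i
    \<comment> \<open>The residual of the eigenvector equation. Varying \<open>v\<close> in the
      direction \<open>y\<close> itself makes the first-order term twice the squared
      \<open>m\<close>-norm of \<open>y\<close>, so the residual vanishes.\<close>
    define y where "y i = Hv i / m i - q * v i" for i
    have my: "m i * y i = Hv i - q * m i * v i" if "i \<in> W" for i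
      using W(3)[OF that] by (simp add: y_def field_simps)
    have "(\<Sum>i\<in>W. Hv i) = (\<Sum>i\<in>W. m i * v i)"
    proof -
      have "(\<Sum>i\<in>W. Hv i) = (\<Sum>j\<in>W. \<Sum>i\<in>W. H i j * v j)"
        unfolding Hv_def by (rule sum.swap)
      also have "\<dots> = (\<Sum>i\<in>W. m i * v i)"
        by (intro sum.cong refl) (simp add: mW sum_distrib_right symW cong: sum.cong)
      finally show ?thesis .
    qed
    then have y0: "(\<Sum>i\<in>W. m i * y i) = 0"
      using v(1) by (simp add: my sum_subtractf mult.assoc sum_distrib_left[symmetric])
    have "2 * (\<Sum>i\<in>W. m i * (y i)\<^sup>2) = 0"
    proof (rule nonpos_linear_coefficient)
      show "2 * (\<Sum>i\<in>W. m i * (y i)\<^sup>2) \<ge> 0"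
        using W(3) by (intro mult_nonneg_nonneg sum_nonneg) (auto simp: less_imp_le)
      fix t :: real
      have "(\<Sum>i\<in>W. m i * (v i + t * y i)) = 0"
        using v(1) y0 by (simp add: algebra_simps sum.distrib sum_distrib_left[symmetric])
      from max[OF this]
      have "quad_form W H v + 2 * t * (\<Sum>i\<in>W. Hv i * y i) + t\<^sup>2 * quad_form W H y
          \<le> q * (\<Sum>i\<in>W. m i * (v i + t * y i)\<^sup>2)"
        using quad_form_add_scale[of W H v t y] symW by (simp add: Hv_def q_def)
      also have "(\<Sum>i\<in>W. m i * (v i + t * y i)\<^sup>2)
          = 1 + 2 * t * (\<Sum>i\<in>W. m i * v i * y i) + t\<^sup>2 * (\<Sum>i\<in>W. m i * (y i)\<^sup>2)"
        unfolding v(2)[symmetric]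
        by (simp add: power2_eq_square algebra_simps sum.distrib sum_distrib_left)
      finally have "2 * t * ((\<Sum>i\<in>W. Hv i * y i) - q * (\<Sum>i\<in>W. m i * v i * y i))
          + t\<^sup>2 * (quad_form W H y - q * (\<Sum>i\<in>W. m i * (y i)\<^sup>2)) \<le> 0"
        by (simp add: q_def algebra_simps)
      moreover have "(\<Sum>i\<in>W. Hv i * y i) - q * (\<Sum>i\<in>W. m i * v i * y i) = (\<Sum>i\<in>W. m i * (y i)\<^sup>2)"
      proof -
        have "(\<Sum>i\<in>W. Hv i * y i) - q * (\<Sum>i\<in>W. m i * v i * y i)
            = (\<Sum>i\<in>W. (Hv i - q * m i * v i) * y i)"
          by (simp add: algebra_simps sum_subtractf sum_distrib_left)
        also have "\<dots> = (\<Sum>i\<in>W. m i * (y i)\<^sup>2)"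
          by (intro sum.cong refl) (simp add: my[symmetric] power2_eq_square)
        finally show ?thesis .
      qed
      ultimately show "t * (2 * (\<Sum>i\<in>W. m i * (y i)\<^sup>2))
          + t\<^sup>2 * (quad_form W H y - q * (\<Sum>i\<in>W. m i * (y i)\<^sup>2)) \<le> 0"
        by simp
    qed
    then have "\<forall>i\<in>W. m i * (y i)\<^sup>2 = 0"
      using sum_nonneg_eq_0_iff[OF W(1), of "\<lambda>i. m i * (y i)\<^sup>2"] W(3) by (simp add: less_imp_le)
    then have Hv: "Hv i = q * m i * v i" if "i \<in> W" for i
      using my[OF that] W(3)[OF that] that by auto
    have "q \<le> (\<Sum>i\<in>W. (Hv i)\<^sup>2 / m i)"
      using key[of v] by (simp add: q_def Hv_def)
    also have "\<dots> = (\<Sum>i\<in>W. q\<^sup>2 * (m i * (v i)\<^sup>2))"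
      using W(3) by (intro sum.cong refl) (simp add: Hv field_simps power2_eq_square less_imp_neq[symmetric])
    also have "\<dots> = q\<^sup>2"
      using v(2) by (simp add: sum_distrib_left[symmetric])
    finally have "1 \<le> q"
      using \<open>q > 0\<close> by (simp add: power2_eq_square)
    \<comment> \<open>The Dirichlet sum equals \<open>2 * (1 - q)\<close>.\<close>
    then have "(\<Sum>i\<in>W. \<Sum>j\<in>W. H i j * (v i - v j)\<^sup>2) \<le> 0"
      using weighted_squares_minus_quad_form[of W H v] symW v(2) by (simp add: mW[symmetric] q_def)
    moreover have H0W: "H i j * (v i - v j)\<^sup>2 \<ge> 0" if "i \<in> W" "j \<in> W" for i j
      using that W(2) H0 by (intro mult_nonneg_nonneg) auto
    ultimately have "(\<Sum>i\<in>W. \<Sum>j\<in>W. H i j * (v i - v j)\<^sup>2) = 0"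
      by (intro order_antisym sum_nonneg)
    then have "\<forall>i\<in>W. \<forall>j\<in>W. H i j * (v i - v j)\<^sup>2 = 0"
      using W(1) H0W by (subst (asm) sum_nonneg_eq_0_iff) (auto simp: sum_nonneg_eq_0_iff intro!: sum_nonneg)
    then have step: "v i = v j" if "i \<in> V" "j \<in> V" "H i j > 0" for i j
      using that offH[of i j] by fastforce
    have const: "v i = v j" if "i \<in> W" "j \<in> W" for i j
    proof -
      have "(\<lambda>x y. x \<in> V \<and> y \<in> V \<and> H x y > 0)\<^sup>*\<^sup>* i j"
        using that W(2,3) by (intro conn) (auto simp: m_def)
      then show ?thesis
        by (induction rule: rtranclp_induct) (auto dest: step)
    qed
    have "(\<Sum>i\<in>W. m i * v i) = v k * (\<Sum>i\<in>W. m i)"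
      using const[OF _ k(2)] by (simp add: sum_distrib_left mult.commute cong: sum.cong)
    moreover have "(\<Sum>i\<in>W. m i) > 0"
      using k W by (intro sum_pos) auto
    ultimately have "v k = 0"
      using v(1) by simp
    then have "\<forall>i\<in>W. v i = 0"
      using const[OF _ k(2)] by simp
    then show False
      using v(2) by simp
  qed
qed (rule sym)

text \<open>
  G models the derivatives of a homogeneous polynomial of degree D, evaluated at the all-ones vector
  and multiplied by the factorial of the remaining degree, which makes Euler's identity factor-free.
\<close>
lemma hyperbolic_at_one_local_to_global:
  fixes G :: "'v multiset \<Rightarrow> real"
  assumes fin: "finite V"
    and nonneg: "\<And>\<alpha>. G \<alpha> \<ge> 0"
    and euler: "\<And>\<alpha>. set_mset \<alpha> \<subseteq> V \<Longrightarrow> size \<alpha> < D \<Longrightarrow> G \<alpha> = (\<Sum>i\<in>V. G (add_mset i \<alpha>))"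
    and base: "\<And>\<alpha>. set_mset \<alpha> \<subseteq> V \<Longrightarrow> size \<alpha> + 2 = D \<Longrightarrow>
       hyperbolic_at_one V (\<lambda>i j. G (add_mset i (add_mset j \<alpha>)))"
    and conn: "\<And>\<alpha> i j. set_mset \<alpha> \<subseteq> V \<Longrightarrow> size \<alpha> + 2 < D \<Longrightarrow> i \<in> V \<Longrightarrow> j \<in> V \<Longrightarrow>
       G (add_mset i \<alpha>) > 0 \<Longrightarrow> G (add_mset j \<alpha>) > 0 \<Longrightarrow>
       (\<lambda>x y. x \<in> V \<and> y \<in> V \<and> G (add_mset x (add_mset y \<alpha>)) > 0)\<^sup>*\<^sup>* i j"
    and "set_mset \<alpha> \<subseteq> V" "size \<alpha> + 2 \<le> D"
  shows "hyperbolic_at_one V (\<lambda>i j. G (add_mset i (add_mset j \<alpha>)))"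
  using assms(6,7)
proof (induction "D - (size \<alpha> + 2)" arbitrary: \<alpha>)
  case 0
  then show ?case by (intro base) auto
next
  case (Suc n)
  have less: "size \<alpha> + 2 < D" using Suc.hyps by simp
  have row: "(\<Sum>j\<in>V. G (add_mset i (add_mset j \<alpha>))) = G (add_mset i \<alpha>)" if "i \<in> V" for i
    using euler[of "add_mset i \<alpha>"] that Suc.prems less by (simp add: add_mset_commute)
  show ?case
  \<comment> \<open>\<open>K l\<close> is the Hessian of the partial derivative in direction
    \<open>l\<close>. Euler's identity decomposes the entries of the Hessian, and it turns a row sum
    of \<open>K l\<close> into an entry of row \<open>l\<close>.\<close>
  proof (rule hyperbolic_at_one_sum[where K = "\<lambda>l i j. G (add_mset i (add_mset j (add_mset l \<alpha>)))"])
    fix l assume l: "l \<in> V"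
    show "hyperbolic_at_one V (\<lambda>i j. G (add_mset i (add_mset j (add_mset l \<alpha>))))"
      using l Suc.hyps(2) Suc.prems less by (intro Suc.hyps(1)) auto
    fix i assume i: "i \<in> V"
    show "(\<Sum>j\<in>V. G (add_mset i (add_mset j (add_mset l \<alpha>)))) = G (add_mset l (add_mset i \<alpha>))"
      using euler[of "add_mset l (add_mset i \<alpha>)"] i l Suc.prems less
      by (simp add: add_mset_commute)
  next
    fix i j assume ij: "i \<in> V" "j \<in> V"
    show "G (add_mset i (add_mset j \<alpha>)) = (\<Sum>l\<in>V. G (add_mset i (add_mset j (add_mset l \<alpha>))))"
      using euler[of "add_mset i (add_mset j \<alpha>)"] ij Suc.prems less
      by (simp add: add_mset_commute)
  next
    fix i j assume ij: "i \<in> V" "j \<in> V"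
      "(\<Sum>l\<in>V. G (add_mset i (add_mset l \<alpha>))) > 0" "(\<Sum>l\<in>V. G (add_mset j (add_mset l \<alpha>))) > 0"
    then show "(\<lambda>x y. x \<in> V \<and> y \<in> V \<and> G (add_mset x (add_mset y \<alpha>)) > 0)\<^sup>*\<^sup>* i j"
      using Suc.prems less by (intro conn) (auto simp: row)
  qed (use fin nonneg in \<open>auto simp: add_mset_commute\<close>)
qed

section \<open>Sums over the classes of an equivalence relation\<close>

lemma sum_equiv_pairs:
  fixes y :: "'a \<Rightarrow> real"
  assumes "finite A" and "equiv A r"
  shows "(\<Sum>a\<in>A. \<Sum>b\<in>A. if (a, b) \<in> r then y a * y b else 0) = (\<Sum>C\<in>A // r. (sum y C)\<^sup>2)"
proof -
  have finC: "finite C" if "C \<in> A // r" for C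
    using that assms finite_equiv_class[of A r] by (auto dest: equiv_type)
  have "(\<Sum>a\<in>A. \<Sum>b\<in>A. if (a, b) \<in> r then y a * y b else 0)
      = (\<Sum>a\<in>\<Union>(A // r). y a * sum y (r `` {a}))"
  proof (rule sum.cong)
    show "A = \<Union>(A // r)"
      using assms by (simp add: Union_quotient)
    fix a assume "a \<in> \<Union>(A // r)"
    have "(\<Sum>b\<in>A. if (a, b) \<in> r then y a * y b else 0) = (\<Sum>b\<in>r `` {a}. y a * y b)"
      using assms equiv_type[OF assms(2)] by (intro sum.mono_neutral_cong_right) auto
    then show "(\<Sum>b\<in>A. if (a, b) \<in> r then y a * y b else 0) = y a * sum y (r `` {a})"
      by (simp add: sum_distrib_left)
  qed
  also have "\<dots> = (\<Sum>C\<in>A // r. \<Sum>a\<in>C. y a * sum y (r `` {a}))"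
    using finC quotient_disj[OF assms(2)] by (subst sum.Union_disjoint) auto
  also have "\<dots> = (\<Sum>C\<in>A // r. (sum y C)\<^sup>2)"
  proof (rule sum.cong[OF refl])
    fix C assume C: "C \<in> A // r"
    have "r `` {a} = C" if "a \<in> C" for a
      using C that assms(2) by (metis equiv_class_eq_iff quotientE Image_singleton_iff)
    then show "(\<Sum>a\<in>C. y a * sum y (r `` {a})) = (sum y C)\<^sup>2"
      by (simp add: sum_distrib_right power2_eq_square)
  qed
  finally show ?thesis .
qed

lemma sum_quotient:
  fixes y :: "'a \<Rightarrow> real"
  assumes "finite A" and "equiv A r"
  shows "(\<Sum>C\<in>A // r. sum y C) = sum y A"
proof -
  have "finite C" if "C \<in> A // r" for C
    using that assms finite_equiv_class[of A r] by (auto dest: equiv_type)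
  then have "(\<Sum>C\<in>A // r. sum y C) = sum y (\<Union>(A // r))"
    using quotient_disj[OF assms(2)] by (subst sum.Union_disjoint) auto
  then show ?thesis
    using assms by (simp add: Union_quotient)
qed

text \<open>Cauchy-Schwarz for the class sums; this is how the number of parallel classes enters the
  estimate.\<close>

lemma sum_squared_le_card_quotient:
  fixes y :: "'a \<Rightarrow> real"
  assumes "finite A" and "equiv A r"
  shows "(sum y A)\<^sup>2 \<le> card (A // r) * (\<Sum>a\<in>A. \<Sum>b\<in>A. if (a, b) \<in> r then y a * y b else 0)"
  using sum_squared_le_sum_of_squares[of "sum y" "A // r"]
  by (simp add: sum_equiv_pairs[OF assms] sum_quotient[OF assms] mult.commute)

section \<open>Matroid lifts of a morphism\<close>

context matroid
begin

lemma finite_indep: "finite \<I>"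
  using finite_ground indep_subset_ground by (meson Pow_iff finite_Pow_iff finite_subset subsetI)

lemma finite_indep_set: "A \<in> \<I> \<Longrightarrow> finite A"
  using finite_ground indep_subset_ground finite_subset by blast

lemma card_le_rank: "A \<in> \<I> \<Longrightarrow> A \<subseteq> S \<Longrightarrow> card A \<le> rank_of \<I> S"
  unfolding rank_of_def using finite_indep by (intro Max_ge) auto

lemma rank_witness:
  obtains A where "A \<in> \<I>" "A \<subseteq> S" "card A = rank_of \<I> S"
proof -
  have "rank_of \<I> S \<in> card ` {A \<in> \<I>. A \<subseteq> S}"
    unfolding rank_of_def using finite_indep empty_indep by (intro Max_in) auto
  then show thesis using that by auto
qed

lemma rank_mono: "S \<subseteq> T \<Longrightarrow> rank_of \<I> S \<le> rank_of \<I> T"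
  by (metis card_le_rank rank_witness subset_trans)

lemma rank_indep: "A \<in> \<I> \<Longrightarrow> rank_of \<I> A = card A"
  by (metis card_le_rank card_mono finite_indep_set order_antisym order_refl rank_witness)

lemma indep_if_card_le_rank:
  assumes "finite S" "card S \<le> rank_of \<I> S"
  shows "S \<in> \<I>"
  using assms rank_witness[of S] by (metis card_seteq)

text \<open>Augment a maximal independent subset of \<open>S\<close> from one of
  \<open>S \<union> T\<close>: by maximality the new element cannot lie in \<open>S\<close>.\<close>

lemma rank_less_union:
  assumes "rank_of \<I> S < rank_of \<I> (S \<union> T)"
  shows "\<exists>x\<in>T. rank_of \<I> S < rank_of \<I> (insert x S)"
proof -
  obtain A where A: "A \<in> \<I>" "A \<subseteq> S" "card A = rank_of \<I> S" by (rule rank_witness)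
  obtain B where B: "B \<in> \<I>" "B \<subseteq> S \<union> T" "card B = rank_of \<I> (S \<union> T)" by (rule rank_witness)
  obtain x where x: "x \<in> B - A" "insert x A \<in> \<I>"
    using augment[of A B] A B assms by auto
  have card: "card (insert x A) = Suc (rank_of \<I> S)"
    using x A finite_indep_set by simp
  have "x \<notin> S"
    using card_le_rank[of "insert x A" S] x A card by auto
  moreover have "card (insert x A) \<le> rank_of \<I> (insert x S)"
    using A x by (intro card_le_rank) auto
  ultimately show ?thesis
    using x B card by (metis DiffD1 Suc_le_eq Un_iff subsetD)
qed

lemma parallel_rel_iff:
  assumes "S \<union> {x} \<in> \<I>" "S \<union> {y} \<in> \<I>" "x \<notin> S" "y \<notin> S"
  shows "(x, y) \<in> parallel_rel X \<I> S \<longleftrightarrow> x = y \<or> insert x (insert y S) \<notin> \<I>"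
  using assms indep_subset_ground by (auto simp: parallel_rel_def continuations_def)

end

locale spanning_morphism = M: matroid X \<I> + N: matroid Y \<J>
  for X :: "'a set" and \<I> and Y :: "'b set" and \<J> +
  fixes \<Phi> :: "'a \<Rightarrow> 'b"
  assumes morphism: "matroid_morphism X \<I> Y \<J> \<Phi>"
    and spanning: "rank_of \<J> (\<Phi> ` X) = rank_of \<J> Y"
begin

definition h :: "'a set \<Rightarrow> nat" where
  "h S = rank_of \<J> (\<Phi> ` S)"

definition r :: nat where
  "r = rank_of \<J> Y"

text \<open>
  The Higgs lift of rank n: its bases are the bases of the morphism with n elements.
\<close>
definition lift :: "nat \<Rightarrow> 'a set set" where
  "lift n = {S \<in> \<I>. r + card S \<le> n + h S}"

lemma h_ground: "h X = r"
  by (simp add: h_def r_def spanning)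

lemma h_mono: "S \<subseteq> T \<Longrightarrow> h S \<le> h T"
  unfolding h_def by (intro N.rank_mono image_mono)

lemma h_le: "S \<subseteq> X \<Longrightarrow> h S \<le> r"
  using h_mono h_ground by metis

lemma h_less_union: "h S < h (S \<union> T) \<Longrightarrow> \<exists>x\<in>T. h S < h (insert x S)"
  using N.rank_less_union[of "\<Phi> ` S" "\<Phi> ` T"] by (auto simp: h_def image_Un)

text \<open>On independent sets the morphism inequality says that cardinality minus \<open>h\<close>
  is monotone. This makes the lifts closed under subsets.\<close>

lemma h_diff_le:
  assumes "S \<subseteq> T" "T \<in> \<I>"
  shows "h T + card S \<le> h S + card T"
proof -
  have "S \<in> \<I>" using assms M.indep_subset by blast
  moreover have "T \<subseteq> X" using assms M.indep_subset_ground by blast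
  ultimately have "int (h T) - int (h S) \<le> int (rank_of \<I> T) - int (rank_of \<I> S)"
    using morphism assms unfolding matroid_morphism_def h_def by blast
  then show ?thesis
    using \<open>S \<in> \<I>\<close> assms by (simp add: M.rank_indep)
qed

text \<open>By the morphism inequality, a jump of the rank of the image forces a jump of the rank in
  the source.\<close>

lemma indep_if_h_less:
  assumes "S \<in> \<I>" "x \<in> X" "h S < h (insert x S)"
  shows "insert x S \<in> \<I>"
proof -
  have fin: "finite S" "S \<subseteq> X"
    using assms M.finite_indep_set M.indep_subset_ground by auto
  have "int (h (insert x S)) - int (h S) \<le> int (rank_of \<I> (insert x S)) - int (rank_of \<I> S)"
    using morphism fin assms unfolding matroid_morphism_def h_def by blast
  then have "card S < rank_of \<I> (insert x S)"
    using assms by (simp add: M.rank_indep)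
  then show ?thesis
    using fin by (intro M.indep_if_card_le_rank) (auto simp: card_insert_if)
qed

text \<open>For \<open>card T = n\<close> the inequality defining the lift reads
  \<open>r \<le> h T\<close>, and \<open>h T\<close> never exceeds \<open>r\<close>.\<close>

lemma bases_iff_lift:
  "T \<in> morphism_bases_of_card \<I> Y \<J> \<Phi> n \<longleftrightarrow> T \<in> lift n \<and> card T = n"
  using h_le[of T] M.indep_subset_ground[of T]
  by (auto simp: morphism_bases_of_card_def morphism_bases_def lift_def h_def r_def)

lemma lift_indep: "S \<in> lift n \<Longrightarrow> S \<in> \<I>"
  by (simp add: lift_def)

lemma lift_ground: "S \<in> lift n \<Longrightarrow> S \<subseteq> X"
  using lift_indep M.indep_subset_ground by blast

lemma finite_lift: "S \<in> lift n \<Longrightarrow> finite S"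
  using lift_indep M.finite_indep_set by blast

lemma lift_subset:
  assumes "T \<in> lift n" "S \<subseteq> T"
  shows "S \<in> lift n"
  using assms h_diff_le[of S T] M.indep_subset[of T S] by (auto simp: lift_def)

lemma lift_Suc: "S \<in> lift n \<Longrightarrow> S \<in> lift (Suc n)"
  by (simp add: lift_def)

lemma lift_insertI:
  assumes "S \<in> lift n" "x \<in> X" "x \<notin> S"
    and "h S < h (insert x S) \<or> insert x S \<in> \<I> \<and> r + card S < n + h S"
  shows "insert x S \<in> lift n"
proof -
  have "card (insert x S) = Suc (card S)"
    using assms finite_lift by simp
  then show ?thesis
    using assms indep_if_h_less[of S x] h_mono[OF subset_insertI, of S x] by (auto simp: lift_def)
qed

text \<open>If the defining inequality of \<open>S\<close> is strict, any augmenting element of the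
  source matroid works. If it is tight, the larger set \<open>T\<close> satisfies
  \<open>h S < h T\<close>, so some element of \<open>T\<close> raises \<open>h\<close>; this
  compensates for the growth of the cardinality.\<close>

lemma matroid_lift:
  assumes "{} \<in> lift n"
  shows "matroid X (lift n)"
proof
  fix S T assume S: "S \<in> lift n" and T: "T \<in> lift n" and less: "card S < card T"
  show "\<exists>x\<in>T - S. insert x S \<in> lift n"
  proof (cases "r + card S < n + h S")
    case True
    obtain x where "x \<in> T - S" "insert x S \<in> \<I>"
      using M.augment less S T lift_indep by blast
    then show ?thesis
      using True S T lift_ground by (intro bexI[of _ x] lift_insertI) auto
  next
    case False
    then have "h S < h T"
      using S T less by (auto simp: lift_def)
    then have "h S < h (S \<union> T)"
      using h_mono[of T "S \<union> T"] by auto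
    then obtain x where x: "x \<in> T" "h S < h (insert x S)"
      using h_less_union by blast
    then have "x \<notin> S" by (auto simp: insert_absorb)
    then show ?thesis
      using x S T lift_ground by (intro bexI[of _ x] lift_insertI) auto
  qed
qed (use assms M.finite_ground in \<open>auto dest: lift_ground intro: lift_subset\<close>)

lemma matroid_liftI: "S \<in> lift n \<Longrightarrow> matroid X (lift n)"
  using matroid_lift lift_subset by blast

text \<open>The dichotomy of the augmentation argument, with the ground set in place of the larger
  set. So the maximal sets of a nonempty \<open>lift n\<close> have exactly \<open>n\<close>
  elements.\<close>

lemma lift_extend:
  assumes S: "S \<in> lift n" and less: "card S < n" and n: "n \<le> rank_of \<I> X"
  obtains x where "x \<in> X - S" "insert x S \<in> lift n"
proof (cases "r + card S < n + h S")
  case True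
  obtain A where A: "A \<in> \<I>" "A \<subseteq> X" "card A = rank_of \<I> X" by (rule M.rank_witness)
  then obtain x where "x \<in> A - S" "insert x S \<in> \<I>"
    using M.augment[of S A] S lift_indep less n by auto
  then show ?thesis
    using that[of x] True S A lift_insertI by auto
next
  case False
  then have "h S < h (S \<union> X)"
    using S less lift_ground[OF S] h_ground by (simp add: Un_absorb1)
  then obtain x where x: "x \<in> X" "h S < h (insert x S)"
    using h_less_union by blast
  then have "x \<notin> S" by (auto simp: insert_absorb)
  then show ?thesis
    using that[of x] x S lift_insertI by auto
qed

text \<open>Transitivity of being parallel over \<open>S\<close>: an element not parallel to
  \<open>x\<close> is not parallel to \<open>y\<close> either. It thus becomes a common neighbour of
  the parallel elements \<open>x\<close> and \<open>y\<close>.\<close>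

lemma lift_parallel_adjacent:
  assumes x: "insert x S \<in> lift n" and y: "insert y S \<in> lift n" "x \<notin> S" "y \<notin> S"
    and xy: "insert x (insert y S) \<notin> lift n"
    and xz: "insert x (insert z S) \<in> lift n" "z \<notin> insert x S"
  shows "insert z (insert y S) \<in> lift n"
proof -
  interpret L: matroid X "lift n" using matroid_liftI x by blast
  have fin: "finite S" using finite_lift[OF x] by simp
  have "card (insert y S) < card (insert x (insert z S))"
    using fin assms by auto
  then obtain e where "e \<in> insert x (insert z S) - insert y S" "insert e (insert y S) \<in> lift n"
    using L.augment[OF y(1) xz(1)] by blast
  then show ?thesis
    using xy by auto
qed

end

section \<open>The homogenised generating polynomial of the bases\<close>

text \<open>
  A multiset of differentiation variables: None stands for the homogenising variable z, which may be
  repeated, and Some x for the variable of x, in which the polynomial is linear.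
\<close>
definition valid_mset :: "'a option multiset \<Rightarrow> bool" where
  "valid_mset \<alpha> \<longleftrightarrow> (\<forall>x. count \<alpha> (Some x) \<le> 1)"

definition supp :: "'a option multiset \<Rightarrow> 'a set" where
  "supp \<alpha> = {x. Some x \<in># \<alpha>}"

lemma supp_add [simp]:
  "supp (add_mset None \<alpha>) = supp \<alpha>" "supp (add_mset (Some x) \<alpha>) = insert x (supp \<alpha>)"
  by (auto simp: supp_def)

lemma supp_empty [simp]: "supp {#} = {}"
  by (simp add: supp_def)

lemma valid_mset_empty [simp]: "valid_mset {#}"
  by (simp add: valid_mset_def)

lemma valid_mset_add [simp]:
  "valid_mset (add_mset None \<alpha>) \<longleftrightarrow> valid_mset \<alpha>"
  "valid_mset (add_mset (Some x) \<alpha>) \<longleftrightarrow> valid_mset \<alpha> \<and> x \<notin> supp \<alpha>"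
proof -
  show "valid_mset (add_mset None \<alpha>) \<longleftrightarrow> valid_mset \<alpha>"
    by (simp add: valid_mset_def)
  have supp: "count \<alpha> (Some x) = 0 \<longleftrightarrow> x \<notin> supp \<alpha>"
    by (simp add: supp_def count_eq_zero_iff)
  have count: "count (add_mset (Some x) \<alpha>) (Some y) = count \<alpha> (Some y) + (if y = x then 1 else 0)" for y
    by simp
  show "valid_mset (add_mset (Some x) \<alpha>) \<longleftrightarrow> valid_mset \<alpha> \<and> x \<notin> supp \<alpha>"
  proof
    assume v: "valid_mset (add_mset (Some x) \<alpha>)"
    have "count \<alpha> (Some y) \<le> 1" for y
      using v[unfolded valid_mset_def, rule_format, of y] unfolding count by linarith
    moreover have "count \<alpha> (Some x) = 0"
      using v[unfolded valid_mset_def, rule_format, of x] unfolding count by simp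
    ultimately show "valid_mset \<alpha> \<and> x \<notin> supp \<alpha>"
      using supp by (simp add: valid_mset_def)
  next
    assume v: "valid_mset \<alpha> \<and> x \<notin> supp \<alpha>"
    then show "valid_mset (add_mset (Some x) \<alpha>)"
      unfolding valid_mset_def count using supp by simp
  qed
qed

lemma finite_supp [simp]: "finite (supp \<alpha>)"
proof -
  have "supp \<alpha> = Some -` set_mset \<alpha>" by (auto simp: supp_def)
  then show ?thesis by (simp add: finite_vimageI)
qed

lemma size_valid_mset: "valid_mset \<alpha> \<Longrightarrow> size \<alpha> = count \<alpha> None + card (supp \<alpha>)"
proof (induction \<alpha>)
  case (add i \<alpha>)
  then show ?case by (cases i) auto
qed simp

locale weighted_spanning_morphism = spanning_morphism X \<I> Y \<J> \<Phi>
  for X :: "'a set" and \<I> and Y :: "'b set" and \<J> and \<Phi> +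
  fixes \<omega> :: "'a \<Rightarrow> real" and k :: nat and s c :: real
  \<comment> \<open>s is the value of the homogenising variable; it tends to 0 in the end.\<close>
  assumes weight_pos: "\<And>x. x \<in> X \<Longrightarrow> \<omega> x > 0"
    and k_pos: "1 \<le> k" and k_less: "k < rank_of \<I> X"
    and s_pos: "s > 0" and c_ge: "c \<ge> 1"
    and c_bound: "\<And>S. S \<in> morphism_bases_of_card \<I> Y \<J> \<Phi> (k - 1) \<Longrightarrow>
      (1 - 1 / c) * card (parallel_classes X \<I> S) \<le> 1"
begin

abbreviation bases :: "nat \<Rightarrow> 'a set set" where
  "bases n \<equiv> morphism_bases_of_card \<I> Y \<J> \<Phi> n"

text \<open>The derivative of e(n) in the variables of \<open>S\<close> at the all-ones point, after
  each variable has been rescaled by its weight.\<close>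

definition weight_above :: "'a set \<Rightarrow> nat \<Rightarrow> real" where
  "weight_above S n = (\<Sum>T | T \<in> bases n \<and> S \<subseteq> T. prod \<omega> T)"

text \<open>\<open>coef j / fact j\<close> is the coefficient of the j-th power of the homogenising
  variable rescaled by \<open>s\<close>. With the factorial split off, differentiation just shifts
  the index.\<close>

definition coef :: "nat \<Rightarrow> real" where
  "coef j = (if j = 0 then 1 else if j = 1 then s else if j = 2 then c * s\<^sup>2 else 0)"

text \<open>The derivative in the variables of \<open>S\<close> and \<open>a\<close> times in the
  homogenising variable, at the all-ones point; \<open>d\<close> is the remaining degree, and
  \<open>fact d\<close> is the normalisation for Euler's identity.\<close>

definition F :: "'a set \<Rightarrow> nat \<Rightarrow> nat \<Rightarrow> real" where
  "F S a d = fact d * (\<Sum>j\<le>d. coef (a + j) / fact j * weight_above S (card S + (d - j)))"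

definition G :: "'a option multiset \<Rightarrow> real" where
  "G \<alpha> = (if valid_mset \<alpha> then F (supp \<alpha>) (count \<alpha> None) (Suc k - size \<alpha>) else 0)"

definition V :: "'a option set" where
  "V = insert None (Some ` X)"

lemma finite_V: "finite V"
  using M.finite_ground by (simp add: V_def)

lemma sum_V: "(\<Sum>i\<in>V. f i) = f None + (\<Sum>x\<in>X. f (Some x))"
  using M.finite_ground by (simp add: V_def sum.reindex)

lemma finite_bases: "finite (bases n)"
  using M.finite_indep by (simp add: morphism_bases_of_card_def morphism_bases_def)

lemma bases_ground: "T \<in> bases n \<Longrightarrow> T \<subseteq> X"
  using bases_iff_lift lift_ground by blast

lemma prod_weight_pos: "T \<subseteq> X \<Longrightarrow> prod \<omega> T > 0"
  by (intro prod_pos) (use weight_pos in auto)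

lemma weight_above_nonneg: "weight_above S n \<ge> 0"
  unfolding weight_above_def using prod_weight_pos bases_ground
  by (intro sum_nonneg) (auto intro: less_imp_le)

lemma coef_pos_iff: "coef j > 0 \<longleftrightarrow> j \<le> 2"
  using s_pos c_ge by (auto simp: coef_def)

lemma coef_nonneg: "coef j \<ge> 0"
  using s_pos c_ge by (auto simp: coef_def)

lemma F_nonneg: "F S a d \<ge> 0"
  unfolding F_def by (intro mult_nonneg_nonneg sum_nonneg divide_nonneg_nonneg)
    (auto simp: coef_nonneg weight_above_nonneg)

lemma G_nonneg: "G \<alpha> \<ge> 0"
  by (simp add: G_def F_nonneg)

section \<open>Euler's identity, support and connectedness of the derivatives\<close>

lemma sum_weight_above_insert:
  assumes "finite S"
  shows "(\<Sum>x\<in>X - S. weight_above (insert x S) n) = (real n - real (card S)) * weight_above S n"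
proof -
  have "(\<Sum>x\<in>X - S. weight_above (insert x S) n)
      = (\<Sum>x\<in>X - S. \<Sum>T\<in>bases n. if insert x S \<subseteq> T then prod \<omega> T else 0)"
    unfolding weight_above_def by (intro sum.cong refl sum.inter_filter finite_bases)
  also have "\<dots> = (\<Sum>T\<in>bases n. \<Sum>x\<in>X - S. if insert x S \<subseteq> T then prod \<omega> T else 0)"
    by (rule sum.swap)
  \<comment> \<open>Double counting: a basis \<open>T\<close> above \<open>S\<close> is met once for
    each element of \<open>T - S\<close>.\<close>
  also have "\<dots> = (\<Sum>T\<in>bases n. if S \<subseteq> T then (real n - real (card S)) * prod \<omega> T else 0)"
  proof (rule sum.cong[OF refl])
    fix T assume "T \<in> bases n"
    then have T: "T \<subseteq> X" "card T = n" "finite T"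
      using bases_ground bases_iff_lift finite_lift by auto
    show "(\<Sum>x\<in>X - S. if insert x S \<subseteq> T then prod \<omega> T else 0)
        = (if S \<subseteq> T then (real n - real (card S)) * prod \<omega> T else 0)"
    proof (cases "S \<subseteq> T")
      case True
      have "(\<Sum>x\<in>X - S. if insert x S \<subseteq> T then prod \<omega> T else 0) = (\<Sum>x\<in>T - S. prod \<omega> T)"
        using T True M.finite_ground by (intro sum.mono_neutral_cong_right) auto
      also have "\<dots> = (real n - real (card S)) * prod \<omega> T"
        using T True assms card_mono[OF T(3) True] by (simp add: card_Diff_subset of_nat_diff)
      finally show ?thesis using True by simp
    qed auto
  qed
  also have "\<dots> = (real n - real (card S)) * weight_above S n"
    unfolding weight_above_def using finite_bases
    by (simp add: sum.inter_filter[symmetric] sum_distrib_left)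
  finally show ?thesis .
qed

text \<open>In the j-th term, \<open>j\<close> of the \<open>Suc d\<close> remaining factors are the
  homogenising variable and the others are elements. The two kinds of derivatives multiply it by
  \<open>j\<close> and by \<open>Suc d - j\<close>; the sum \<open>Suc d\<close> is absorbed by the
  factorial.\<close>

lemma F_Suc:
  assumes "finite S"
  shows "F S a (Suc d) = F S (Suc a) d + (\<Sum>x\<in>X - S. F (insert x S) a d)"
proof -
  define g where "g j = coef (a + j) / fact j * weight_above S (card S + (Suc d - j))" for j
  have "(\<Sum>x\<in>X - S. F (insert x S) a d) = fact d * (\<Sum>j\<le>d. (real (Suc d) - real j) * g j)"
  proof -
    have "(\<Sum>x\<in>X - S. F (insert x S) a d) = fact d * (\<Sum>j\<le>d. coef (a + j) / fact j *
        (\<Sum>x\<in>X - S. weight_above (insert x S) (card S + (Suc d - j))))"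
      unfolding F_def sum_distrib_left using assms
      by (subst sum.swap) (intro sum.cong refl, simp add: Suc_diff_le)
    also have "\<dots> = fact d * (\<Sum>j\<le>d. (real (Suc d) - real j) * g j)"
      by (rule arg_cong[where f = "(*) (fact d)"], rule sum.cong[OF refl])
        (simp add: sum_weight_above_insert[OF assms] g_def)
    finally show ?thesis .
  qed
  also have "(\<Sum>j\<le>d. (real (Suc d) - real j) * g j) = (\<Sum>j\<le>Suc d. (real (Suc d) - real j) * g j)"
    by simp
  finally have 1: "(\<Sum>x\<in>X - S. F (insert x S) a d)
      = fact d * (\<Sum>j\<le>Suc d. (real (Suc d) - real j) * g j)" .
  have "(\<Sum>j\<le>Suc d. real j * g j) = (\<Sum>j\<le>d. real (Suc j) * g (Suc j))"
    by (subst sum.atMost_Suc_shift) simp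
  also have "\<dots> = (\<Sum>j\<le>d. coef (Suc a + j) / fact j * weight_above S (card S + (d - j)))"
    by (intro sum.cong refl) (simp add: g_def divide_simps del: of_nat_Suc)
  finally have 2: "F S (Suc a) d = fact d * (\<Sum>j\<le>Suc d. real j * g j)"
    by (simp add: F_def)
  have "F S a (Suc d) = fact (Suc d) * (\<Sum>j\<le>Suc d. g j)"
    by (simp only: F_def g_def)
  also have "\<dots> = fact d * (\<Sum>j\<le>Suc d. real (Suc d) * g j)"
    by (simp only: sum_distrib_left[symmetric] fact_Suc mult.assoc mult.left_commute)
  also have "\<dots> = fact d * (\<Sum>j\<le>Suc d. real j * g j)
      + fact d * (\<Sum>j\<le>Suc d. (real (Suc d) - real j) * g j)"
    by (simp only: distrib_left[symmetric] sum.distrib[symmetric] distrib_right[symmetric]) simp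
  finally show ?thesis
    by (simp only: 1 2)
qed

lemma weight_above_card:
  assumes "finite S"
  shows "weight_above S (card S) = (if S \<in> lift (card S) then prod \<omega> S else 0)"
proof -
  have "{T. T \<in> bases (card S) \<and> S \<subseteq> T} = (if S \<in> lift (card S) then {S} else {})"
    using assms finite_lift by (auto simp: bases_iff_lift dest: card_subset_eq[rotated])
  then show ?thesis
    by (simp add: weight_above_def)
qed

lemma F_0: "finite S \<Longrightarrow> F S a 0 = (if S \<in> lift (card S) then coef a * prod \<omega> S else 0)"
  by (simp add: F_def weight_above_card)

text \<open>All summands of Euler's identity are nonnegative, so positivity passes to and from
  derivatives. One direction uses that lifts are closed under subsets and grow with their index; the
  other extends \<open>S\<close> by one element, which \<open>k < rank_of \<I> X\<close>
  permits.\<close>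

lemma F_pos_iff:
  assumes "finite S" "card S + d + a = Suc k"
  shows "F S a d > 0 \<longleftrightarrow> S \<in> lift (card S + d) \<and> a \<le> 2"
  using assms
proof (induction d arbitrary: S a)
  case 0
  then show ?case
    using prod_weight_pos[of S] lift_ground[of S] coef_nonneg[of a]
    by (auto simp: F_0 zero_less_mult_iff coef_pos_iff)
next
  case (Suc d)
  have IH: "F (insert x S) a d > 0 \<longleftrightarrow> insert x S \<in> lift (card S + Suc d) \<and> a \<le> 2"
    if "x \<in> X - S" for x
    using Suc.IH[of "insert x S" a] Suc.prems that by simp
  have sum0: "(\<Sum>x\<in>X - S. F (insert x S) a d) \<ge> 0"
    by (intro sum_nonneg F_nonneg)
  show ?case
  proof
    assume "F S a (Suc d) > 0"
    then consider "F S (Suc a) d > 0" | "(\<Sum>x\<in>X - S. F (insert x S) a d) > 0"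
      using F_nonneg[of S "Suc a" d] sum0 unfolding F_Suc[OF Suc.prems(1)] by linarith
    then show "S \<in> lift (card S + Suc d) \<and> a \<le> 2"
    proof cases
      case 1
      then show ?thesis
        using Suc.IH[of S "Suc a"] Suc.prems lift_Suc by auto
    next
      case 2
      then obtain x where "x \<in> X - S" "F (insert x S) a d > 0"
        by (meson sum_nonpos not_le)
      then show ?thesis
        using IH lift_subset[of "insert x S" _ S] by blast
    qed
  next
    assume S: "S \<in> lift (card S + Suc d) \<and> a \<le> 2"
    obtain x where x: "x \<in> X - S" "insert x S \<in> lift (card S + Suc d)"
      using lift_extend[of S "card S + Suc d"] S Suc.prems k_less by auto
    then have "F (insert x S) a d > 0"
      using IH S by blast
    then have "(\<Sum>x\<in>X - S. F (insert x S) a d) > 0"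
      using x M.finite_ground by (intro sum_pos2[of _ x]) (auto simp: F_nonneg)
    then show "F S a (Suc d) > 0"
      unfolding F_Suc[OF Suc.prems(1)] using F_nonneg[of S "Suc a" d] by linarith
  qed
qed

lemma G_euler:
  assumes "size \<alpha> < Suc k"
  shows "G \<alpha> = (\<Sum>i\<in>V. G (add_mset i \<alpha>))"
proof (cases "valid_mset \<alpha>")
  case True
  obtain d where d: "Suc k - size \<alpha> = Suc d" "k - size \<alpha> = d"
    using assms by (metis Suc_diff_le less_Suc_eq_le)
  have "(\<Sum>x\<in>X. G (add_mset (Some x) \<alpha>))
      = (\<Sum>x\<in>X - supp \<alpha>. F (insert x (supp \<alpha>)) (count \<alpha> None) d)"
    using True M.finite_ground d by (intro sum.mono_neutral_cong_right) (auto simp: G_def)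
  then show ?thesis
    using True d F_Suc[of "supp \<alpha>" "count \<alpha> None" d] by (simp add: sum_V G_def)
qed (simp add: sum_V G_def)

lemma G_pos_iff:
  assumes "valid_mset \<alpha>" "size \<alpha> \<le> Suc k"
  shows "G \<alpha> > 0 \<longleftrightarrow> supp \<alpha> \<in> lift (Suc k - count \<alpha> None) \<and> count \<alpha> None \<le> 2"
proof -
  have "card (supp \<alpha>) + (Suc k - size \<alpha>) = Suc k - count \<alpha> None"
    using assms size_valid_mset[of \<alpha>] by simp
  moreover have "card (supp \<alpha>) + (Suc k - size \<alpha>) + count \<alpha> None = Suc k"
    using assms size_valid_mset[of \<alpha>] by simp
  ultimately show ?thesis
    using assms F_pos_iff[of "supp \<alpha>" "Suc k - size \<alpha>" "count \<alpha> None"] by (simp add: G_def)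
qed

text \<open>Two parallel elements have a common nonparallel neighbour, found by extending one of
  them inside \<open>lift n\<close>. The homogenising variable is adjacent to an element that
  extends \<open>S\<close> inside \<open>lift (n - 1)\<close>, and this element is also a vertex for
  \<open>lift n\<close>.\<close>

lemma G_connected:
  assumes size: "size \<alpha> + 2 < Suc k" and ij: "i \<in> V" "j \<in> V"
    and pos: "G (add_mset i \<alpha>) > 0" "G (add_mset j \<alpha>) > 0"
  shows "(\<lambda>x y. x \<in> V \<and> y \<in> V \<and> G (add_mset x (add_mset y \<alpha>)) > 0)\<^sup>*\<^sup>* i j"
proof -
  let ?E = "\<lambda>x y. x \<in> V \<and> y \<in> V \<and> G (add_mset x (add_mset y \<alpha>)) > 0"
  define S where "S = supp \<alpha>"
  define a where "a = count \<alpha> None"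
  define n where "n = Suc k - a"
  have valid: "valid_mset \<alpha>"
    using pos(1) by (cases i) (auto simp: G_def split: if_splits)
  have card: "card S + a = size \<alpha>"
    using size_valid_mset[OF valid] by (simp add: S_def a_def)
  have n: "n \<le> rank_of \<I> X" "card S + 2 < n" "Suc (n - 1) = n"
    using k_less card size by (auto simp: n_def)
  have Some_pos: "x \<notin> S \<and> insert x S \<in> lift n \<and> a \<le> 2"
    if "G (add_mset (Some x) \<alpha>) > 0" for x
  proof -
    have v: "valid_mset (add_mset (Some x) \<alpha>)"
      using that by (simp add: G_def split: if_splits)
    then show ?thesis
      using that size valid G_pos_iff[OF v] by (simp add: S_def a_def n_def)
  qed
  have None_pos: "S \<in> lift (n - 1) \<and> a \<le> 1" if "G (add_mset None \<alpha>) > 0"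
    using that size valid G_pos_iff[of "add_mset None \<alpha>"] by (simp add: S_def a_def n_def)
  have edge: "?E (Some x) (Some y)"
    if "x \<notin> S" "y \<notin> S" "x \<noteq> y" "insert x (insert y S) \<in> lift n" "a \<le> 2" for x y
    using that size valid lift_ground[OF that(4)]
      G_pos_iff[of "add_mset (Some x) (add_mset (Some y) \<alpha>)"]
    by (auto simp: S_def a_def n_def V_def)
  have edge0: "?E None (Some x)"
    if "x \<notin> S" "insert x S \<in> lift (n - 1)" "a \<le> 1" for x
    using that size valid lift_ground[OF that(2)]
      G_pos_iff[of "add_mset None (add_mset (Some x) \<alpha>)"]
    by (auto simp: S_def a_def n_def V_def)
  have SS: "?E\<^sup>*\<^sup>* (Some x) (Some y)"
    if x: "x \<notin> S" "insert x S \<in> lift n" and y: "y \<notin> S" "insert y S \<in> lift n" and a: "a \<le> 2" for x y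
  proof (cases "x = y \<or> insert x (insert y S) \<in> lift n")
    case True
    then show ?thesis using edge[of x y] x y a by auto
  next
    case False
    have "finite S" by (simp add: S_def)
    then obtain z where z: "z \<in> X - insert x S" "insert z (insert x S) \<in> lift n"
      using lift_extend[OF x(2) _ n(1)] n x by auto
    have "insert z (insert y S) \<in> lift n"
      using lift_parallel_adjacent[of x S n y z] False x y z by (auto simp: insert_commute)
    moreover have "z \<noteq> y"
      using z False by (auto simp: insert_commute)
    ultimately have "?E (Some x) (Some z)" "?E (Some z) (Some y)"
      using edge[of x z] edge[of z y] x y z a by (auto simp: insert_commute)
    then show ?thesis by (rule converse_rtranclp_into_rtranclp[OF _ r_into_rtranclp])
  qed
  have NS: "?E\<^sup>*\<^sup>* None (Some y)"
    if S: "S \<in> lift (n - 1)" "a \<le> 1" and y: "y \<notin> S" "insert y S \<in> lift n" for y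
  proof -
    have "card S < n - 1" "n - 1 \<le> rank_of \<I> X"
      using n by auto
    then obtain z where z: "z \<in> X - S" "insert z S \<in> lift (n - 1)"
      by (rule lift_extend[OF S(1)])
    then have "?E None (Some z)" using edge0 S by blast
    moreover have "?E\<^sup>*\<^sup>* (Some z) (Some y)"
      using SS[of z y] z y S lift_Suc[OF z(2)] n by simp
    ultimately show ?thesis by (rule converse_rtranclp_into_rtranclp)
  qed
  have "symp ?E" by (auto simp: symp_def add_mset_commute)
  then have sym: "?E\<^sup>*\<^sup>* x y" if "?E\<^sup>*\<^sup>* y x" for x y
    using that by (metis (no_types, lifting) sympD symp_rtranclp)
  show ?thesis
  proof (cases i)
    case None
    then show ?thesis
      using pos None_pos Some_pos NS by (cases j) auto
  next
    case (Some x)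
    then show ?thesis
      using pos None_pos Some_pos NS[of x] SS[of x] sym by (cases j) auto
  qed
qed

end

section \<open>The quadratic derivatives\<close>

lemma sum_nonadjacent:
  fixes y :: "'a \<Rightarrow> real"
  shows "(\<Sum>a\<in>A. \<Sum>b\<in>A. if (a, b) \<in> r then 0 else y a * y b)
    = (sum y A)\<^sup>2 - (\<Sum>a\<in>A. \<Sum>b\<in>A. if (a, b) \<in> r then y a * y b else 0)"
proof -
  have "(sum y A)\<^sup>2 = (\<Sum>a\<in>A. \<Sum>b\<in>A. y a * y b)"
    by (simp add: power2_eq_square sum_product)
  also have "\<dots> = (\<Sum>a\<in>A. \<Sum>b\<in>A. if (a, b) \<in> r then 0 else y a * y b)
      + (\<Sum>a\<in>A. \<Sum>b\<in>A. if (a, b) \<in> r then y a * y b else 0)"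
    unfolding sum.distrib[symmetric] by (intro sum.cong refl) simp
  finally show ?thesis by simp
qed

context weighted_spanning_morphism
begin

text \<open>Here \<open>n = Suc k - a\<close>. With two degrees left every entry is a single
  monomial: \<open>S\<close> together with two, one or no further elements, which must lie in
  \<open>lift n\<close>, \<open>lift (n - 1)\<close> or \<open>lift (n - 2)\<close>. In the first
  block the nonzero entries are the nonparallel pairs, which gives a complete multipartite
  graph.\<close>

lemma quad_form_G:
  assumes valid: "valid_mset \<alpha>" and size: "size \<alpha> + 2 = Suc k"
    and S_def: "S = supp \<alpha>" and a_def: "a = count \<alpha> None" and n_def: "n = card S + 2"
    and S: "S \<in> lift n" and A_def: "A = continuations X (lift n) S"
  shows "quad_form V (\<lambda>i j. G (add_mset i (add_mset j \<alpha>))) v = prod \<omega> S *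
    (coef a * (\<Sum>x\<in>A. \<Sum>y\<in>A. if (x, y) \<in> parallel_rel X (lift n) S then 0
        else \<omega> x * v (Some x) * (\<omega> y * v (Some y)))
     + 2 * coef (Suc a) * v None * (\<Sum>x | x \<in> A \<and> insert x S \<in> lift (n - 1). \<omega> x * v (Some x))
     + (if S \<in> lift (n - 2) then coef (a + 2) * (v None)\<^sup>2 else 0))"
proof -
  interpret L: matroid X "lift n" using matroid_liftI S by blast
  have fin: "finite S" "S \<subseteq> X" using S finite_lift lift_ground by auto
  have A: "x \<in> A \<longleftrightarrow> x \<in> X - S \<and> insert x S \<in> lift n" for x
    by (auto simp: A_def continuations_def)
  have finA: "finite A" "A \<subseteq> X"
    using M.finite_ground A by (auto intro: finite_subset)
  have n1: "lift (n - 1) \<subseteq> lift n"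
    using lift_Suc[of _ "n - 1"] by (auto simp: n_def)
  have e00: "G (add_mset None (add_mset None \<alpha>))
      = (if S \<in> lift (n - 2) then coef (a + 2) * prod \<omega> S else 0)"
    using valid size fin by (simp add: G_def F_0 S_def a_def n_def)
  have e0: "G (add_mset None (add_mset (Some x) \<alpha>))
      = (if x \<in> A \<and> insert x S \<in> lift (n - 1) then prod \<omega> S * coef (Suc a) * \<omega> x else 0)" if "x \<in> X" for x
    using valid size fin that A[of x] n1 by (auto simp: G_def F_0 S_def a_def n_def)
  have e: "G (add_mset (Some x) (add_mset (Some y) \<alpha>))
      = (if x \<in> A \<and> y \<in> A \<and> (x, y) \<notin> parallel_rel X (lift n) S
         then prod \<omega> S * coef a * (\<omega> x * \<omega> y) else 0)" if "x \<in> X" "y \<in> X" for x y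
  proof (cases "x \<notin> S \<and> y \<notin> S \<and> x \<noteq> y \<and> insert x (insert y S) \<in> lift n")
    case True
    then have "x \<in> A" "y \<in> A"
      using A that lift_subset[of "insert x (insert y S)" n "insert x S"]
        lift_subset[of "insert x (insert y S)" n "insert y S"] by auto
    then show ?thesis
      using valid size fin True L.parallel_rel_iff[of S x y] A
      by (simp add: G_def F_0 S_def a_def n_def)
  next
    case False
    then have "x \<in> A \<and> y \<in> A \<Longrightarrow> (x, y) \<in> parallel_rel X (lift n) S"
      using L.parallel_rel_iff[of S x y] A by auto
    moreover have "G (add_mset (Some x) (add_mset (Some y) \<alpha>)) = 0"
      using False valid size fin by (auto simp: G_def F_0 S_def a_def n_def)
    ultimately show ?thesis by auto
  qed
  have "(\<Sum>x\<in>X. \<Sum>y\<in>X. G (add_mset (Some x) (add_mset (Some y) \<alpha>)) * v (Some x) * v (Some y))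
      = (\<Sum>x\<in>A. \<Sum>y\<in>A. prod \<omega> S * coef a * (if (x, y) \<in> parallel_rel X (lift n) S then 0
        else \<omega> x * v (Some x) * (\<omega> y * v (Some y))))"
  proof (rule sum.mono_neutral_cong_right)
    fix x assume x: "x \<in> A"
    show "(\<Sum>y\<in>X. G (add_mset (Some x) (add_mset (Some y) \<alpha>)) * v (Some x) * v (Some y))
      = (\<Sum>y\<in>A. prod \<omega> S * coef a * (if (x, y) \<in> parallel_rel X (lift n) S then 0
        else \<omega> x * v (Some x) * (\<omega> y * v (Some y))))"
      using finA M.finite_ground x by (intro sum.mono_neutral_cong_right) (auto simp: e subset_iff)
  qed (use finA M.finite_ground in \<open>auto simp: e intro!: sum.neutral\<close>)
  moreover have "(\<Sum>x\<in>X. G (add_mset None (add_mset (Some x) \<alpha>)) * v (Some x))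
      = (\<Sum>x | x \<in> A \<and> insert x S \<in> lift (n - 1). prod \<omega> S * coef (Suc a) * (\<omega> x * v (Some x)))"
    using finA M.finite_ground by (intro sum.mono_neutral_cong_right) (auto simp: e0 subset_iff)
  then have "(\<Sum>x\<in>X. G (add_mset None (add_mset (Some x) \<alpha>)) * v (Some x))
      = prod \<omega> S * coef (Suc a) * (\<Sum>x | x \<in> A \<and> insert x S \<in> lift (n - 1). \<omega> x * v (Some x))"
    by (simp only: sum_distrib_left)
  moreover have "quad_form V (\<lambda>i j. G (add_mset i (add_mset j \<alpha>))) v
     = (\<Sum>x\<in>X. \<Sum>y\<in>X. G (add_mset (Some x) (add_mset (Some y) \<alpha>)) * v (Some x) * v (Some y))
      + 2 * v None * (\<Sum>x\<in>X. G (add_mset None (add_mset (Some x) \<alpha>)) * v (Some x))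
      + G (add_mset None (add_mset None \<alpha>)) * (v None)\<^sup>2"
    by (simp add: quad_form_def sum_V sum.distrib sum_distrib_left add_mset_commute power2_eq_square
        algebra_simps)
  ultimately show ?thesis
    by (simp add: e00 sum_distrib_left[symmetric] algebra_simps)
qed

text \<open>Each case exhibits a hyperplane on which the form is nonpositive. The cases record
  whether the border and the corner of the matrix can be nonzero.\<close>

lemma hyperbolic_top:
  assumes size: "size \<alpha> + 2 = Suc k"
  shows "hyperbolic_at_one V (\<lambda>i j. G (add_mset i (add_mset j \<alpha>)))"
proof -
  define S where "S = supp \<alpha>"
  define a where "a = count \<alpha> None"
  define n where "n = card S + 2"
  define A where "A = continuations X (lift n) S"
  define par where "par = parallel_rel X (lift n) S"
  define Q where "Q = quad_form V (\<lambda>i j. G (add_mset i (add_mset j \<alpha>)))"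
  define y where "y v x = \<omega> x * v (Some x)" for v :: "'a option \<Rightarrow> real" and x
  have A: "x \<in> A \<longleftrightarrow> x \<in> X - S \<and> insert x S \<in> lift n" for x
    by (auto simp: A_def continuations_def)
  have finA: "finite A" "A \<subseteq> X"
    using M.finite_ground A by (auto intro: finite_subset)
  have hypI: "hyperbolic_at_one V (\<lambda>i j. G (add_mset i (add_mset j \<alpha>)))"
    if neg: "\<And>v. b * v None + g * sum (y v) A = 0 \<Longrightarrow> Q v \<le> 0" for b g
  proof (rule hyperbolic_at_oneI)
    fix v :: "'a option \<Rightarrow> real"
    let ?l = "\<lambda>i. case i of None \<Rightarrow> b | Some x \<Rightarrow> if x \<in> A then g * \<omega> x else 0"
    assume "(\<Sum>i\<in>V. ?l i * v i) = 0"
    moreover have "(\<Sum>x\<in>X. (if x \<in> A then g * \<omega> x else 0) * v (Some x)) = (\<Sum>x\<in>A. g * y v x)"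
      using finA M.finite_ground by (intro sum.mono_neutral_cong_right) (auto simp: y_def)
    ultimately have "b * v None + g * sum (y v) A = 0"
      by (simp add: sum_V sum_distrib_left)
    then show "quad_form V (\<lambda>i j. G (add_mset i (add_mset j \<alpha>))) v \<le> 0"
      using neg by (simp add: Q_def)
  qed (auto simp: G_nonneg add_mset_commute)
  show ?thesis
  proof (cases "valid_mset \<alpha> \<and> S \<in> lift n")
    case False
    \<comment> \<open>A positive entry would put a superset of \<open>S\<close> into a lift of index
      at most \<open>n\<close>, and hence \<open>S\<close> itself into
      \<open>lift n\<close>.\<close>
    have "G (add_mset i (add_mset j \<alpha>)) = 0" for i j
    proof (rule ccontr)
      assume "G (add_mset i (add_mset j \<alpha>)) \<noteq> 0"
      then have pos: "G (add_mset i (add_mset j \<alpha>)) > 0"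
        using G_nonneg[of "add_mset i (add_mset j \<alpha>)"] by simp
      then have v: "valid_mset (add_mset i (add_mset j \<alpha>))"
        by (simp add: G_def split: if_splits)
      then have valid: "valid_mset \<alpha>"
        by (cases i; cases j) auto
      have "count (add_mset i (add_mset j \<alpha>)) None \<ge> a"
        by (simp add: a_def)
      then have le: "Suc k - count (add_mset i (add_mset j \<alpha>)) None \<le> n"
        using size size_valid_mset[OF valid] by (simp add: S_def a_def n_def)
      have "supp (add_mset i (add_mset j \<alpha>)) \<in> lift (Suc k - count (add_mset i (add_mset j \<alpha>)) None)"
        using G_pos_iff[OF v] pos size by simp
      moreover have "S \<subseteq> supp (add_mset i (add_mset j \<alpha>))"
        by (auto simp: supp_def S_def)
      ultimately have "S \<in> lift (Suc k - count (add_mset i (add_mset j \<alpha>)) None)"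
        using lift_subset by blast
      then have "S \<in> lift n"
        using le by (auto simp: lift_def)
      with False valid show False by simp
    qed
    then show ?thesis
      by (simp add: hyperbolic_at_one_def quad_form_def)
  next
    case True
    then have valid: "valid_mset \<alpha>" and S: "S \<in> lift n" by auto
    interpret L: matroid X "lift n" using matroid_liftI S by blast
    have S': "S \<subseteq> X" "finite S" "S \<in> \<I>"
      using S lift_ground finite_lift lift_indep by auto
    have card: "card S + a + 2 = Suc k"
      using size size_valid_mset[OF valid] by (simp add: S_def a_def)
    have par: "equiv A par"
      unfolding A_def par_def by (rule L.equiv_parallel_rel[OF S])
    define A' where "A' = {x \<in> A. insert x S \<in> lift (n - 1)}"
    define P where "P v = (\<Sum>x\<in>A. \<Sum>z\<in>A. if (x, z) \<in> par then y v x * y v z else 0)" for v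
    have Q: "Q v = prod \<omega> S * (coef a * ((sum (y v) A)\<^sup>2 - P v)
        + 2 * coef (Suc a) * v None * sum (y v) A'
        + (if S \<in> lift (n - 2) then coef (a + 2) * (v None)\<^sup>2 else 0))" for v
      using quad_form_G[OF valid size S_def a_def n_def S A_def, of v, folded par_def]
      unfolding P_def sum_nonadjacent[symmetric] Q_def y_def A'_def by simp
    have P: "P v = (\<Sum>C\<in>A // par. (sum (y v) C)\<^sup>2)" for v
      unfolding P_def by (rule sum_equiv_pairs[OF finA(1) par])
    have P0: "P v \<ge> 0" for v
      unfolding P by (intro sum_nonneg) simp
    have w0: "prod \<omega> S \<ge> 0"
      using prod_weight_pos[OF S'(1)] by simp
    consider (border0) "S \<notin> lift (n - 1)"
      | (corner0) "S \<in> lift (n - 1)" "a > 0 \<or> S \<notin> lift (n - 2)"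
      | (corner) "a = 0" "S \<in> lift (n - 2)"
      by blast
    then show ?thesis
    proof cases
      case border0
      then have "A' = {}" "S \<notin> lift (n - 2)"
        using lift_subset[of "insert _ S" "n - 1" S] lift_Suc[of S "n - 2"]
        by (auto simp: A'_def n_def)
      then have "Q v \<le> 0" if "sum (y v) A = 0" for v
        using that w0 P0[of v] coef_nonneg[of a]
        by (simp add: Q mult_nonneg_nonneg)
      then show ?thesis
        by (intro hypI[of 0 1]) simp
    next
      case corner0
      have corner: "(if S \<in> lift (n - 2) then coef (a + 2) * (v None)\<^sup>2 else 0) = 0" for v :: "'a option \<Rightarrow> real"
        using corner0(2) by (auto simp: coef_def)
      \<comment> \<open>The elements outside A' form at most one parallel class, which absorbs the border.\<close>
      have hx: "h (insert x S) < r \<and> h (insert x S) = h S" if "x \<in> A - A'" for x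
      proof -
        have "r + Suc (card S) > n - 1 + h (insert x S)"
          using that A[of x] S' by (auto simp: A'_def lift_def)
        moreover have "r + card S \<le> n - 1 + h S"
          using corner0(1) by (simp add: lift_def)
        ultimately show ?thesis
          using h_mono[OF subset_insertI, of S x] by (simp add: n_def)
      qed
      have P_ge: "(sum (y v) (A - A'))\<^sup>2 \<le> P v" for v
      proof (cases "A - A' = {}")
        case True
        then show ?thesis using P0[of v] by (simp only: sum.empty) simp
      next
        case False
        then obtain x where x: "x \<in> A - A'" by blast
        have "A - A' = par `` {x}"
        proof (intro equalityI subsetI)
          fix z assume z: "z \<in> A - A'"
          \<comment> \<open>Neither element raises \<open>h\<close> above \<open>h S\<close>, so the
            pair does not either, while membership in \<open>lift n\<close> would require the value
            \<open>r\<close>.\<close>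
          have "insert x (insert z S) \<notin> lift n" if "x \<noteq> z"
          proof
            assume "insert x (insert z S) \<in> lift n"
            then have "r \<le> h (S \<union> {x, z})"
              using that x z A S' by (simp add: lift_def n_def insert_commute)
            then have "h S < h (S \<union> {x, z})"
              using hx[OF x] by simp
            then show False
              using h_less_union[of S "{x, z}"] hx[OF x] hx[OF z] by auto
          qed
          then show "z \<in> par `` {x}"
            using x z A L.parallel_rel_iff[of S x z] by (auto simp: par_def)
        next
          fix z assume z: "z \<in> par `` {x}"
          then have zA: "z \<in> A"
            using equiv_type[OF par] by auto
          show "z \<in> A - A'"
          proof (rule ccontr)
            assume "\<not> ?thesis"
            \<comment> \<open>An element of \<open>A'\<close> brings \<open>h\<close> up to
              \<open>r\<close>, so it still raises \<open>h\<close> after \<open>x\<close> has been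
              added; then the pair lies in \<open>lift n\<close> and is not parallel.\<close>
            then have z': "z \<in> A'" using zA by simp
            then have "z \<noteq> x" using x by auto
            have "r \<le> h (insert z S)"
              using z' A[of z] S' by (auto simp: A'_def lift_def n_def)
            also have "h (insert z S) \<le> h (insert z (insert x S))"
              by (intro h_mono) auto
            finally have "h (insert x S) < h (insert z (insert x S))"
              using hx[OF x] by simp
            then have "insert z (insert x S) \<in> lift n"
              using x zA A \<open>z \<noteq> x\<close> lift_insertI[of "insert x S" n z] by auto
            then show False
              using z \<open>z \<noteq> x\<close> x zA A L.parallel_rel_iff[of S x z]
              by (auto simp: par_def insert_commute)
          qed
        qed
        then have "A - A' \<in> A // par"
          using x by (auto intro: quotientI)
        then show ?thesis
          unfolding P using finA par by (intro member_le_sum) (auto simp: finite_quotient equiv_type)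
      qed
      \<comment> \<open>The substitution turns the cross term into a difference of squares. Its
        positive square is the one over \<open>A - A'\<close>, which is either 0 or a term of
        \<open>P v\<close>.\<close>
      have "Q v \<le> 0" if l: "coef (Suc a) * v None + coef a * sum (y v) A = 0" for v
      proof -
        have split: "sum (y v) A = sum (y v) A' + sum (y v) (A - A')"
          using finA by (subst sum.subset_diff[of A' A]) (auto simp: A'_def)
        have "coef a * ((sum (y v) A)\<^sup>2 - P v) + 2 * coef (Suc a) * v None * sum (y v) A'
           = coef a * ((sum (y v) A)\<^sup>2 - P v) + 2 * (coef (Suc a) * v None) * sum (y v) A'"
          by simp
        also have "coef (Suc a) * v None = - coef a * sum (y v) A"
          using l by linarith
        also have "coef a * ((sum (y v) A)\<^sup>2 - P v) + 2 * (- coef a * sum (y v) A) * sum (y v) A'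
           = coef a * ((sum (y v) A)\<^sup>2 - P v - 2 * sum (y v) A * sum (y v) A')"
          by (simp add: algebra_simps)
        also have "\<dots> = coef a * ((sum (y v) (A - A'))\<^sup>2 - P v - (sum (y v) A')\<^sup>2)"
          by (simp add: split power2_eq_square algebra_simps)
        also have "\<dots> \<le> 0"
          using P_ge[of v] coef_nonneg[of a] zero_le_power2[of "sum (y v) A'"]
          by (intro mult_nonneg_nonpos) linarith+
        finally show ?thesis
          unfolding Q corner using w0 by (simp add: mult_nonneg_nonpos)
      qed
      then show ?thesis by (rule hypI)
    next
      case corner
      have Sb: "S \<in> bases (k - 1)"
        using corner card by (auto simp: bases_iff_lift n_def)
      have rS: "r \<le> h S"
        using corner(2) by (simp add: lift_def n_def)
      \<comment> \<open>Since the image of \<open>S\<close> already has full rank, above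
        \<open>S\<close> the lifts are truncations of the source matroid. So \<open>A\<close> and
        \<open>par\<close> are those of the source, and \<open>c_bound\<close> applies.\<close>
      have lift_iff: "T \<in> lift m \<longleftrightarrow> T \<in> \<I> \<and> card T \<le> m" if "S \<subseteq> T" "T \<subseteq> X" for T m
        using rS h_mono[OF that(1)] h_le[OF that(2)] by (auto simp: lift_def)
      have cont: "A = continuations X \<I> S"
        using S' lift_iff[OF subset_insertI, of _ n] by (auto simp: A_def continuations_def n_def)
      have "par = parallel_rel X \<I> S"
      proof -
        have "insert x (insert z S) \<in> lift n \<longleftrightarrow> insert x (insert z S) \<in> \<I>" if "x \<in> A" "z \<in> A" for x z
        proof -
          have "card (insert x (insert z S)) \<le> n"
            using S' by (simp add: n_def card_insert_if)
          then show ?thesis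
            using that A S' lift_iff[of "insert x (insert z S)" n] by auto
        qed
        then show ?thesis
          unfolding par_def parallel_rel_def A_def[symmetric] cont[symmetric] by auto
      qed
      then have bound: "(1 - 1 / c) * card (A // par) \<le> 1"
        using c_bound[OF Sb] by (simp add: parallel_classes_def cont)
      have "A' = A"
        using A S' lift_iff[OF subset_insertI, of _ "n - 1"] lift_indep
        by (auto simp: A'_def n_def)
      \<comment> \<open>The condition says that the form is stationary in the coordinate
        \<open>v None\<close>.\<close>
      have "Q v \<le> 0" if l: "c * s * v None + 1 * sum (y v) A = 0" for v
      proof -
        define t where "t = sum (y v) A"
        have "(1 - 1 / c) * t\<^sup>2 \<le> (1 - 1 / c) * (card (A // par) * P v)"
          unfolding t_def P_def using c_ge
          by (intro mult_left_mono sum_squared_le_card_quotient finA par) auto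
        also have "\<dots> \<le> 1 * P v"
          using mult_right_mono[OF bound P0[of v]] by (simp add: mult.assoc)
        finally have le: "t\<^sup>2 - P v - t\<^sup>2 / c \<le> 0"
          by (simp add: algebra_simps)
        have sv: "s * v None = - t / c"
          using l c_ge by (simp add: t_def field_simps)
        have "coef a * (t\<^sup>2 - P v) + 2 * coef (Suc a) * v None * t + coef (a + 2) * (v None)\<^sup>2
            = t\<^sup>2 - P v + 2 * (s * v None) * t + c * (s * v None)\<^sup>2"
          using corner by (simp add: coef_def power_mult_distrib)
        also have "\<dots> = t\<^sup>2 - P v - t\<^sup>2 / c"
          unfolding sv using c_ge by (simp add: power2_eq_square field_simps)
        finally show ?thesis
          unfolding Q using le w0 corner \<open>A' = A\<close> by (simp add: t_def mult_nonneg_nonpos)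
      qed
      then show ?thesis by (rule hypI)
    qed
  qed
qed

section \<open>The inequality at a positive value of the homogenising variable\<close>

lemma hyperbolic_G: "hyperbolic_at_one V (\<lambda>i j. G {#i, j#})"
proof -
  have "hyperbolic_at_one V (\<lambda>i j. G (add_mset i (add_mset j {#})))"
  proof (rule hyperbolic_at_one_local_to_global[where D = "Suc k" and G = G and V = V and \<alpha> = "{#}"])
    show "G \<alpha> = (\<Sum>i\<in>V. G (add_mset i \<alpha>))" if "size \<alpha> < Suc k" for \<alpha>
      using that by (rule G_euler)
    show "hyperbolic_at_one V (\<lambda>i j. G (add_mset i (add_mset j \<alpha>)))" if "size \<alpha> + 2 = Suc k" for \<alpha>
      using that by (rule hyperbolic_top)
    show "(\<lambda>x y. x \<in> V \<and> y \<in> V \<and> G (add_mset x (add_mset y \<alpha>)) > 0)\<^sup>*\<^sup>* i j"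
      if "size \<alpha> + 2 < Suc k" "i \<in> V" "j \<in> V" "G (add_mset i \<alpha>) > 0" "G (add_mset j \<alpha>) > 0" for \<alpha> i j
      using that by (rule G_connected)
    show "size {#} + 2 \<le> Suc k"
      using k_pos by simp
  qed (simp_all add: finite_V G_nonneg)
  then show ?thesis by simp
qed

text \<open>Reverse Cauchy-Schwarz tested on the unit vector of the homogenising variable: the three
  quantities are the derivatives of order two, one and zero in that variable, and the common factor
  \<open>q\<close> cancels.\<close>

lemma perturbed_inequality:
  defines "w \<equiv> weighted_bases \<I> Y \<J> \<Phi> \<omega>"
  shows "c * w (k - 1) * ((1 + 1 / k) * (w (k + 1) + s * w k + c * s\<^sup>2 / 2 * w (k - 1)))
    \<le> (w k + c * s * w (k - 1))\<^sup>2"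
proof -
  define v :: "'a option \<Rightarrow> real" where "v i = (if i = None then 1 else 0)" for i
  obtain m where m: "k = Suc m" using k_pos by (cases k) auto
  have w: "weight_above {} n = w n" for n
    by (simp add: weight_above_def w_def weighted_bases_def)
  have F_eq: "F {} a d = fact d * (\<Sum>j\<le>min d (2 - a). coef (a + j) / fact j * w (d - j))" if "a \<le> 2" for a d
  proof -
    have "F {} a d = fact d * (\<Sum>j\<le>d. coef (a + j) / fact j * w (d - j))"
      by (simp only: F_def w card.empty add_0)
    also have "(\<Sum>j\<le>d. coef (a + j) / fact j * w (d - j))
        = (\<Sum>j\<le>min d (2 - a). coef (a + j) / fact j * w (d - j))"
      using that by (intro sum.mono_neutral_right) (auto simp: coef_def)
    finally show ?thesis .
  qed
  have G_eq_F: "G {#None, None#} = F {} 2 m" "G {#None#} = F {} 1 (Suc m)"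
    "G {#} = F {} 0 (Suc (Suc m))"
    unfolding G_def by (simp_all add: m numeral_2_eq_2)
  have G2: "G {#None, None#} = fact m * (c * s\<^sup>2 * w m)"
    unfolding G_eq_F by (simp add: F_eq coef_def)
  have G1: "G {#None#} = fact (Suc m) * (s * w (Suc m) + c * s\<^sup>2 * w m)"
    unfolding G_eq_F by (simp add: F_eq coef_def del: fact_Suc)
  have G0: "G {#} = fact (Suc (Suc m)) * (w (Suc (Suc m)) + s * w (Suc m) + c * s\<^sup>2 / 2 * w m)"
    unfolding G_eq_F by (simp add: F_eq coef_def numeral_2_eq_2)
  have row: "(\<Sum>j\<in>V. G {#i, j#}) = G {#i#}" for i
    using G_euler[of "{#i#}"] m by (simp add: add_mset_commute)
  have total: "(\<Sum>i\<in>V. \<Sum>j\<in>V. G {#i, j#}) = G {#}"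
    using G_euler[of "{#}"] by (simp add: row)
  have quad: "quad_form V (\<lambda>i j. G {#i, j#}) v = G {#None, None#}"
    by (simp add: quad_form_def sum_V v_def)
  have lin: "(\<Sum>i\<in>V. (\<Sum>j\<in>V. G {#i, j#}) * v i) = G {#None#}"
    by (simp add: row sum_V v_def)
  have "G {#None, None#} * G {#} \<le> (G {#None#})\<^sup>2"
    using hyperbolic_G[unfolded hyperbolic_at_one_def, rule_format, of v] by (simp only: quad lin total)
  moreover define q :: real where "q = (fact (Suc m) * s)\<^sup>2"
  moreover have "G {#None, None#} * G {#}
      = q * (c * w (k - 1) * ((1 + 1 / k) * (w (k + 1) + s * w k + c * s\<^sup>2 / 2 * w (k - 1))))"
  proof -
    have "fact m * fact (Suc (Suc m)) = (fact (Suc m))\<^sup>2 * (1 + 1 / real (Suc m))"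
      by (simp add: power2_eq_square divide_simps)
    moreover have "G {#None, None#} * G {#} = fact m * fact (Suc (Suc m)) *
        (c * s\<^sup>2 * w m * (w (Suc (Suc m)) + s * w (Suc m) + c * s\<^sup>2 / 2 * w m))"
      by (simp only: G2 G0 mult_ac)
    ultimately have "G {#None, None#} * G {#} = q * (c * w m *
        ((1 + 1 / real (Suc m)) * (w (Suc (Suc m)) + s * w (Suc m) + c * s\<^sup>2 / 2 * w m)))"
      by (simp only: q_def power_mult_distrib mult_ac)
    moreover have "k - 1 = m" "k + 1 = Suc (Suc m)"
      using m by simp_all
    ultimately show ?thesis
      by (simp only: m[symmetric])
  qed
  moreover have "(G {#None#})\<^sup>2 = q * (w k + c * s * w (k - 1))\<^sup>2"
  proof -
    have "G {#None#} = fact (Suc m) * s * (w k + c * s * w (k - 1))"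
      unfolding G1 by (simp add: m power2_eq_square distrib_left mult_ac del: fact_Suc)
    then show ?thesis
      by (simp only: q_def power_mult_distrib)
  qed
  moreover have "q > 0"
    using s_pos by (simp add: q_def del: fact_Suc)
  ultimately show ?thesis
    by (metis mult_le_cancel_left_pos)
qed

end

section \<open>Log-concavity\<close>

theorem theorem1p16:
  fixes X :: "'a set" and \<I> :: "'a set set"
    and Y :: "'b set" and \<J> :: "'b set set"
    and \<Phi> :: "'a \<Rightarrow> 'b" and \<omega> :: "'a \<Rightarrow> real" and k :: nat
  assumes "matroid X \<I>" and "matroid Y \<J>"
    and "matroid_morphism X \<I> Y \<J> \<Phi>"
    and "\<And>x. x \<in> X \<Longrightarrow> \<omega> x > 0"
    and "1 \<le> k" and "k < rank_of \<I> X"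
  shows "(weighted_bases \<I> Y \<J> \<Phi> \<omega> k)\<^sup>2
    \<ge> (1 + 1 / real k) * (1 + 1 / (real (max_parallel_classes X \<I> Y \<J> \<Phi> (k - 1)) - 1))
      * weighted_bases \<I> Y \<J> \<Phi> \<omega> (k - 1) * weighted_bases \<I> Y \<J> \<Phi> \<omega> (k + 1)"
proof (cases "morphism_bases_of_card \<I> Y \<J> \<Phi> (k - 1) = {}")
  case True
  then have "weighted_bases \<I> Y \<J> \<Phi> \<omega> (k - 1) = 0"
    by (simp add: weighted_bases_def)
  then show ?thesis by simp
next
  case False
  interpret M: matroid X \<I> by fact
  interpret N: matroid Y \<J> by fact
  define p where "p = max_parallel_classes X \<I> Y \<J> \<Phi> (k - 1)"
  define c where "c = 1 + 1 / (real p - 1)"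
  define w where "w = weighted_bases \<I> Y \<J> \<Phi> \<omega>"
  obtain S where S: "S \<in> morphism_bases_of_card \<I> Y \<J> \<Phi> (k - 1)"
    using False by blast
  then have S': "S \<in> \<I>" "card S = k - 1" "rank_of \<J> (\<Phi> ` S) = rank_of \<J> Y"
    by (auto simp: morphism_bases_of_card_def morphism_bases_def)
  have fin: "finite (morphism_bases_of_card \<I> Y \<J> \<Phi> n)" for n
    using M.finite_indep by (simp add: morphism_bases_of_card_def morphism_bases_def)
  have p_ge: "card (parallel_classes X \<I> T) \<le> p"
    if "T \<in> morphism_bases_of_card \<I> Y \<J> \<Phi> (k - 1)" for T
    using that False fin by (auto simp: p_def max_parallel_classes_def intro!: Max_ge)
  \<comment> \<open>The value \<open>p = 0\<close> would make \<open>c\<close> equal to 0. It is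
    excluded because a set of \<open>k - 1\<close> independent elements can still be
    extended.\<close>
  have "p \<ge> 1"
  proof -
    obtain A where "A \<in> \<I>" "card A = rank_of \<I> X" by (rule M.rank_witness)
    moreover from this have "card S < card A"
      using S' assms by simp
    ultimately obtain x where x: "x \<in> A - S" "insert x S \<in> \<I>"
      using M.augment S' by blast
    then have "continuations X \<I> S \<noteq> {}"
      using M.indep_subset_ground by (fastforce simp: continuations_def)
    moreover have "finite (continuations X \<I> S)"
      using M.finite_ground by (simp add: continuations_def)
    ultimately have "card (parallel_classes X \<I> S) \<noteq> 0"
      using M.equiv_parallel_rel[OF S'(1)]
      by (simp add: parallel_classes_def finite_quotient equiv_type)
    then show ?thesis using p_ge[OF S] by simp
  qed
  have c: "c \<ge> 1"
    using \<open>p \<ge> 1\<close> by (simp add: c_def)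
  have c_bound: "(1 - 1 / c) * card (parallel_classes X \<I> T) \<le> 1"
    if "T \<in> morphism_bases_of_card \<I> Y \<J> \<Phi> (k - 1)" for T
  proof (cases "p = 1")
    case True
    \<comment> \<open>Division by zero yields 0, so \<open>c = 1\<close> and the left factor
      vanishes.\<close>
    then show ?thesis by (simp add: c_def)
  next
    case False
    then have "real p > 1" using \<open>p \<ge> 1\<close> by simp
    then have "1 - 1 / c = 1 / p"
      by (simp add: c_def field_simps)
    then show ?thesis
      using p_ge[OF that] \<open>p \<ge> 1\<close> by simp
  qed
  \<comment> \<open>A basis of the morphism exists, so the image of the ground set has full rank;
    the lifts are built on this.\<close>
  have span: "rank_of \<J> (\<Phi> ` X) = rank_of \<J> Y"
  proof (rule order_antisym)
    show "rank_of \<J> (\<Phi> ` X) \<le> rank_of \<J> Y"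
      using assms(3) by (intro N.rank_mono) (auto simp: matroid_morphism_def)
    show "rank_of \<J> Y \<le> rank_of \<J> (\<Phi> ` X)"
      using S' M.indep_subset_ground N.rank_mono by (metis image_mono)
  qed
  have ineq: "c * w (k - 1) * ((1 + 1 / k) * (w (k + 1) + s * w k + c * s\<^sup>2 / 2 * w (k - 1)))
      \<le> (w k + c * s * w (k - 1))\<^sup>2" if "s > 0" for s
  proof -
    interpret weighted_spanning_morphism X \<I> Y \<J> \<Phi> \<omega> k s c
      by unfold_locales (use assms span c c_bound that in auto)
    show ?thesis
      using perturbed_inequality by (simp add: w_def)
  qed
  \<comment> \<open>The description of the support relies on \<open>s > 0\<close>, so the value 0 is
    reached as a limit from the right.\<close>
  have "c * w (k - 1) * ((1 + 1 / k) * (w (k + 1) + 0 * w k + c * 0\<^sup>2 / 2 * w (k - 1)))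
      \<le> (w k + c * 0 * w (k - 1))\<^sup>2"
  proof (rule tendsto_le[OF trivial_limit_at_right_real])
    show "((\<lambda>s. (w k + c * s * w (k - 1))\<^sup>2) \<longlongrightarrow> (w k + c * 0 * w (k - 1))\<^sup>2) (at_right 0)"
      by (intro tendsto_intros)
    show "((\<lambda>s. c * w (k - 1) * ((1 + 1 / k) * (w (k + 1) + s * w k + c * s\<^sup>2 / 2 * w (k - 1))))
      \<longlongrightarrow> c * w (k - 1) * ((1 + 1 / k) * (w (k + 1) + 0 * w k + c * 0\<^sup>2 / 2 * w (k - 1))))
      (at_right 0)"
      by (intro tendsto_intros) auto
    show "\<forall>\<^sub>F s in at_right 0. c * w (k - 1) *
        ((1 + 1 / k) * (w (k + 1) + s * w k + c * s\<^sup>2 / 2 * w (k - 1))) \<le> (w k + c * s * w (k - 1))\<^sup>2"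
      unfolding eventually_at_right_field using ineq by (intro exI[of _ 1]) auto
  qed
  then show ?thesis
    by (simp add: w_def c_def p_def mult_ac)
qed

end
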